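(* Let $k\in\{1,2,\dots\}$, let $\varepsilon>0$, and let $n:\mathbb{N}\to\mathbb{N}$ be any function with $1\le n(d)\le 2^d$ for all $d$ and $n(d)\ge k+1$ for all sufficiently large $d$. For each $d\in\mathbb{N}$, choose an $n(d)$-element subset $W$ of $\{0,1\}^d$ uniformly at random, and set $P:=\operatorname{conv} W\subset\mathbb{R}^d$. Let $\tau_k = 1-(1-2^{-k})H_{k+1}$. Then the expected $k$-face density of $P$ satisfies, as $d\to\infty$, $$ \mathbb{E}[\varphi_k(P)] = \begin{cases} 1-o(1) & \text{if } n(d)\le 2^{(\tau_k-\varepsilon)d} \text{ for all } d,\\ o(1) & \text{if } n(d)\ge 2^{(\tau_k+\varepsilon)d}\text{ for all } d.\end{cases} $$
   Context: $\log$ denotes the binary logarithm. For $0<\xi<1$, $h(\xi):=\xi\log\frac1\xi+(1-\xi)\log\frac1{1-\xi}$ is the binary entropy function. For $r\ge 2$, $$H_r := \frac{1}{2^r-2}\sum_{i=1}^{r-1}\binom{r}{i}h\!\left(\tfrac{i}{r}\right).$$ For a polytope $Q$ with exactly $n$ vertices, $n\ge k+1$, the $k$-face density of $Q$ is $\varphi_k(Q):=f_k(Q)/\binom{n}{k+1}$, where $f_k(Q)$ is the number of $k$-dimensional faces of $Q$ (the polytope $Q$ itself counts as a face of $Q$; $f_k(Q)=0$ if $k>\dim Q$). Every point of $W\subseteq\{0,1\}^d$ is a vertex of $\operatorname{conv}W$, so $P$ has exactly $n(d)$ vertices. The $o(1)$ terms refer to $d\to\infty$ with $k$, $\varepsilon$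 and the function $n$ fixed. *)

theory Defs
  imports
    "HOL-Probability.Probability"
    "HOL-Library.Function_Algebras"
    "HOL-Library.Landau_Symbols"
begin

text \<open>
  The dimension \<open>d\<close> varies within the statement, so \<open>\<real>\<^sup>d\<close> cannot be a type. As in
  \<^theory>\<open>HOL-Analysis.Abstract_Euclidean_Space\<close>, it is the set of all
  \<open>x :: nat \<Rightarrow> real\<close> with \<open>x i = 0\<close> for all \<open>i \<ge> d\<close>. The pointwise vector space structure
  makes \<open>convex hull\<close>, \<open>face_of\<close> and \<open>extreme_point_of\<close> available there.
\<close>

instantiation "fun" :: (type, real_vector) real_vector
begin

definition scaleR_fun_def: "c *\<^sub>R f = (\<lambda>x. c *\<^sub>R f x)"

instance
  by standard (simp_all add: scaleR_fun_def fun_eq_iff algebra_simps)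

end

lemma scaleR_fun_apply [simp]: "(c *\<^sub>R f) x = c *\<^sub>R f x"
  by (simp add: scaleR_fun_def)

definition cube01 :: "nat \<Rightarrow> (nat \<Rightarrow> real) set" where
  "cube01 d = {x \<in> topspace (Euclidean_space d). \<forall>i<d. x i \<in> {0, 1}}"

lemma bij_betw_Pow_cube01:
  "bij_betw (\<lambda>A i. if i \<in> A then 1 else 0) (Pow {..<d}) (cube01 d)"
proof (rule bij_betw_byWitness[where f' = "\<lambda>x. {i. x i = 1}"])
  show "\<forall>x\<in>cube01 d. (\<lambda>i. if i \<in> {i. x i = 1} then 1 else 0) = x"
  proof (intro ballI ext)
    fix x :: "nat \<Rightarrow> real" and i :: nat
    assume "x \<in> cube01 d"
    then show "(if i \<in> {i. x i = 1} then 1 else 0) = x i"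
      by (cases "i < d") (auto simp: cube01_def topspace_Euclidean_space)
  qed
  show "(\<lambda>x. {i. x i = 1}) ` cube01 d \<subseteq> Pow {..<d}"
    by (auto simp: cube01_def topspace_Euclidean_space) (metis not_less zero_neq_one)
qed (auto simp: cube01_def topspace_Euclidean_space)

lemma finite_cube01: "finite (cube01 d)"
  using bij_betw_finite[OF bij_betw_Pow_cube01] by simp

lemma card_cube01: "card (cube01 d) = 2 ^ d"
  using bij_betw_same_card[OF bij_betw_Pow_cube01] by (simp add: card_Pow)

text \<open>
  The set sampled from is finite, and nonempty for \<open>m \<le> 2 ^ d\<close>.
\<close>

definition random_subset :: "nat \<Rightarrow> nat \<Rightarrow> (nat \<Rightarrow> real) set pmf" where
  "random_subset d m = pmf_of_set {W. W \<subseteq> cube01 d \<and> card W = m}"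

lemma finite_subsets_cube01: "finite {W. W \<subseteq> cube01 d \<and> card W = m}"
  by (rule finite_subset[of _ "Pow (cube01 d)"]) (auto simp: finite_cube01)

lemma subsets_cube01_nonempty: "m \<le> 2 ^ d \<Longrightarrow> {W. W \<subseteq> cube01 d \<and> card W = m} \<noteq> {}"
  using obtain_subset_with_card_n[of m "cube01 d"] card_cube01[of d] by auto

text \<open>
  The library restricts \<^const>\<open>aff_dim\<close> to Euclidean space types; this is the same
  definition for arbitrary real vector spaces. It is meant for sets whose affine hull has
  finite dimension.
\<close>

definition affine_dim :: "'a::real_vector set \<Rightarrow> int" where
  "affine_dim V = (SOME d :: int.
     \<exists>B. affine hull B = affine hull V \<and> \<not> affine_dependent B \<and> of_nat (card B) = d + 1)"

lemma affine_dim_eq_aff_dim: "affine_dim V = aff_dim V" for V :: "'a::euclidean_space set"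
  by (simp add: affine_dim_def aff_dim_def)

definition num_faces :: "nat \<Rightarrow> 'a::real_vector set \<Rightarrow> nat" where
  "num_faces k Q = card {F. F face_of Q \<and> affine_dim F = int k}"

definition num_vertices :: "'a::real_vector set \<Rightarrow> nat" where
  "num_vertices Q = card {v. v extreme_point_of Q}"

definition face_density :: "nat \<Rightarrow> 'a::real_vector set \<Rightarrow> real" where
  "face_density k Q = real (num_faces k Q) / real (num_vertices Q choose (k + 1))"

definition expected_face_density :: "nat \<Rightarrow> nat \<Rightarrow> nat \<Rightarrow> real" where
  "expected_face_density k d m =
     measure_pmf.expectation (random_subset d m) (\<lambda>W. face_density k (convex hull W))"

definition binary_entropy :: "real \<Rightarrow> real" where
  "binary_entropy \<xi> = \<xi> * log 2 (1 / \<xi>) + (1 - \<xi>) * log 2 (1 / (1 - \<xi>))"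

definition H_avg :: "nat \<Rightarrow> real" where
  "H_avg r = 1 / (2 ^ r - 2) *
     (\<Sum>i = 1..r - 1. real (r choose i) * binary_entropy (real i / real r))"

definition \<tau> :: "nat \<Rightarrow> real" where
  "\<tau> k = 1 - (1 - 2 powr (- real k)) * H_avg (k + 1)"

end

(*
  For k + 1 random vertices, write r = k + 1 and encode the vertices by the column sets in which the
  coordinates 1 occur; by Chebyshev's inequality every subset of {0, ..., r - 1} is the column of about
  d / 2^r coordinates. The product distribution on the cube whose mean is the barycenter b of the
  vertices has entropy about (1 - tau_k) d.

  Below the threshold, its log-likelihood, rescaled on each class of columns by the actual class size,
  is a linear functional constant on the vertices, and at most 2^((1 - tau_k + eta) d) cube points
  reach this value. With high probability no other point of W does, and the vertices span a face.

  Above the threshold, b lies in conv(W - S) with high probability, so that no face of dimension k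
  contains the vertices S. Indeed every half-space containing b has mass at least 1 / r under the
  product distribution, hence contains at least 2^((1 - tau_k - eta) d) cube points; it is missed by W
  with doubly exponentially small probability, while by the Sauer-Shelah bound half-spaces cut out only
  2^(d^2) + 1 different subsets of the cube.
*)

theory Submission
  imports Defs "HOL-Real_Asymp.Real_Asymp"
begin

text \<open>Both regimes estimate one quantity: the least number of cube points in a half-space
  containing b. The product distribution measures it because it has the largest entropy among the
  distributions on the cube with mean b. A random m-set has about m 2^(- tau_k d) points in a set of
  size 2^((1 - tau_k) d), whence the threshold. The rescaling answers the obstacle that the column
  classes have only approximately equal sizes: the plain log-likelihood would in general take
  different values on the r vertices and so could not expose their simplex. A k-face of P need not
  be a simplex. The density is therefore compared with pairs (S, W), where S is an r-subset of W:
  for the upper bound S affinely spans a face, for the lower bound S is independent and conv S is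
  itself a face. All distributions are uniform on finite sets, so the probabilistic estimates are
  cardinality bounds.\<close>

section \<open>Second moments over finite products, and binomial estimates\<close>

lemma sum_PiE_insert:
  assumes "a \<notin> I"
  shows "(\<Sum>c\<in>PiE (insert a I) Q. F c) = (\<Sum>c\<in>PiE I Q. \<Sum>t\<in>Q a. F (c(a := t)))"
proof -
  have "(\<Sum>c\<in>PiE (insert a I) Q. F c) = (\<Sum>(t, c)\<in>Q a \<times> PiE I Q. F (c(a := t)))"
    unfolding PiE_insert_eq using inj_combinator[OF assms, of Q]
    by (subst sum.reindex) (auto simp: split_def)
  also have "\<dots> = (\<Sum>t\<in>Q a. \<Sum>c\<in>PiE I Q. F (c(a := t)))"
    by (rule sum.cartesian_product[symmetric])
  also have "\<dots> = (\<Sum>c\<in>PiE I Q. \<Sum>t\<in>Q a. F (c(a := t)))"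
    by (rule sum.swap)
  finally show ?thesis .
qed

text \<open>Variances of independent centred summands add: when the square is expanded for one new
  coordinate, the cross term vanishes because \<open>g a\<close> sums to 0 over
  \<open>Q\<close>.\<close>

lemma sum_PiE_square_le:
  fixes g :: "'a \<Rightarrow> 'b \<Rightarrow> real" and B :: real
  assumes "finite I" "finite Q"
    and "\<And>j. j \<in> I \<Longrightarrow> (\<Sum>t\<in>Q. g j t) = 0"
    and "\<And>j t. j \<in> I \<Longrightarrow> t \<in> Q \<Longrightarrow> \<bar>g j t\<bar> \<le> B"
  shows "(\<Sum>c\<in>PiE I (\<lambda>_. Q). (\<Sum>j\<in>I. g j (c j))\<^sup>2) \<le> card I * card Q ^ card I * B\<^sup>2"
  using assms(1,3,4)
proof (induction I rule: finite_induct)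
  case empty
  then show ?case by simp
next
  case (insert a I)
  define G where "G c = (\<Sum>j\<in>I. g j (c j))" for c
  let ?P = "PiE I (\<lambda>_. Q)"
  have G: "(\<Sum>j\<in>insert a I. g j ((c(a := t)) j)) = g a t + G c" for c t
  proof -
    have "(\<Sum>j\<in>I. g j ((c(a := t)) j)) = G c"
      unfolding G_def using insert.hyps by (intro sum.cong) auto
    then show ?thesis using insert.hyps by simp
  qed
  have inner: "(\<Sum>t\<in>Q. (g a t + G c)\<^sup>2) \<le> card Q * B\<^sup>2 + card Q * (G c)\<^sup>2" for c
  proof -
    have "(\<Sum>t\<in>Q. (g a t + G c)\<^sup>2) = (\<Sum>t\<in>Q. (g a t)\<^sup>2) + 2 * G c * (\<Sum>t\<in>Q. g a t) + card Q * (G c)\<^sup>2"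
      by (simp add: power2_sum sum.distrib sum_distrib_left mult_ac)
    also have "\<dots> = (\<Sum>t\<in>Q. (g a t)\<^sup>2) + card Q * (G c)\<^sup>2"
      using insert.prems(1)[of a] by simp
    also have "(\<Sum>t\<in>Q. (g a t)\<^sup>2) \<le> (\<Sum>t\<in>Q. B\<^sup>2)"
      using insert.prems(2)[of a] by (intro sum_mono) (metis abs_ge_zero insertI1 power2_abs power_mono)
    finally show ?thesis by simp
  qed
  have "(\<Sum>c\<in>PiE (insert a I) (\<lambda>_. Q). (\<Sum>j\<in>insert a I. g j (c j))\<^sup>2)
      = (\<Sum>c\<in>?P. \<Sum>t\<in>Q. (g a t + G c)\<^sup>2)"
    by (subst sum_PiE_insert[OF insert.hyps(2)]) (simp only: G)
  also have "\<dots> \<le> (\<Sum>c\<in>?P. card Q * B\<^sup>2 + card Q * (G c)\<^sup>2)"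
    by (intro sum_mono inner)
  also have "\<dots> = card Q ^ card I * (card Q * B\<^sup>2) + card Q * (\<Sum>c\<in>?P. (G c)\<^sup>2)"
    using insert.hyps by (simp add: sum.distrib sum_distrib_left card_PiE)
  also have "\<dots> \<le> card Q ^ card I * (card Q * B\<^sup>2) + card Q * (card I * card Q ^ card I * B\<^sup>2)"
    unfolding G_def using insert.prems by (intro add_left_mono mult_left_mono insert.IH) auto
  also have "\<dots> = card (insert a I) * card Q ^ card (insert a I) * B\<^sup>2"
    using insert.hyps by (simp add: algebra_simps)
  finally show ?case .
qed

text \<open>Chebyshev's inequality in counting form. It serves twice: for the frequencies of the
  columns, with \<open>Q = Pow {..<r}\<close>, and for the log-probability of a cube point, with
  \<open>Q = {..<r}\<close>.\<close>

lemma card_PiE_deviation_le: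
  fixes g :: "'a \<Rightarrow> 'b \<Rightarrow> real" and B :: real
  assumes "finite I" "finite Q"
    and "\<And>j. j \<in> I \<Longrightarrow> (\<Sum>t\<in>Q. g j t) = 0"
    and "\<And>j t. j \<in> I \<Longrightarrow> t \<in> Q \<Longrightarrow> \<bar>g j t\<bar> \<le> B"
    and "\<eta> > 0"
  shows "card {c \<in> PiE I (\<lambda>_. Q). \<bar>\<Sum>j\<in>I. g j (c j)\<bar> > \<eta>}
    \<le> card I * card Q ^ card I * B\<^sup>2 / \<eta>\<^sup>2"
proof -
  let ?P = "PiE I (\<lambda>_. Q)"
  let ?D = "{c \<in> ?P. \<bar>\<Sum>j\<in>I. g j (c j)\<bar> > \<eta>}"
  have fin: "finite ?P" using assms by (intro finite_PiE) auto
  have "card ?D * \<eta>\<^sup>2 = (\<Sum>c\<in>?D. \<eta>\<^sup>2)" by simp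
  also have "\<dots> \<le> (\<Sum>c\<in>?D. (\<Sum>j\<in>I. g j (c j))\<^sup>2)"
    using \<open>\<eta> > 0\<close> by (intro sum_mono) (auto simp: abs_le_square_iff[symmetric])
  also have "\<dots> \<le> (\<Sum>c\<in>?P. (\<Sum>j\<in>I. g j (c j))\<^sup>2)"
    using fin by (intro sum_mono2) auto
  also have "\<dots> \<le> card I * card Q ^ card I * B\<^sup>2"
    using sum_PiE_square_le[OF assms(1-4)] by simp
  finally show ?thesis using \<open>\<eta> > 0\<close> by (simp add: field_simps)
qed

lemma sum_Pow_card:
  fixes f :: "nat \<Rightarrow> real"
  assumes "finite A"
  shows "(\<Sum>T\<in>Pow A. f (card T)) = (\<Sum>i\<le>card A. real (card A choose i) * f i)"
proof -
  have "(\<Sum>T\<in>Pow A. f (card T)) = (\<Sum>i\<le>card A. \<Sum>T\<in>{T\<in>Pow A. card T = i}. f (card T))"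
    using assms by (intro sum.group[symmetric]) (auto intro: card_mono)
  also have "\<dots> = (\<Sum>i\<le>card A. real (card {T. T \<subseteq> A \<and> card T = i}) * f i)"
    by (intro sum.cong) auto
  finally show ?thesis using assms by (simp add: n_subsets)
qed

text \<open>Divided by \<open>M choose m\<close>, the left side is the probability that a random
  m-subset of an M-set misses a given a-set. Excluding one more point costs a factor 1 - m / (K +
  1), which is at most 1 - m / M.\<close>

lemma binomial_diff_le:
  fixes M m a :: nat
  assumes "m \<le> M" "a \<le> M" "M > 0"
  shows "real ((M - a) choose m) \<le> (1 - m / M) ^ a * real (M choose m)"
  using assms(2)
proof (induction a)
  case (Suc a)
  define K where "K = M - Suc a"
  have K: "M - a = Suc K" using Suc.prems by (simp add: K_def)
  have *: "real (K choose m) \<le> (1 - m / M) * real (Suc K choose m)"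
  proof (cases "m \<le> K")
    case True
    have "(Suc K - m) * (Suc K choose m) = Suc K * (K choose m)"
      using True binomial_absorb_comp[of "Suc K" m] by simp
    then have "real (Suc K - m) * real (Suc K choose m) = real (Suc K) * real (K choose m)"
      by (metis of_nat_mult)
    then have "real (K choose m) = (1 - m / real (Suc K)) * real (Suc K choose m)"
      using True by (simp add: field_simps of_nat_diff)
    also have "\<dots> \<le> (1 - m / M) * real (Suc K choose m)"
      using K Suc.prems by (intro mult_right_mono diff_left_mono divide_left_mono) auto
    finally show ?thesis .
  next
    case False
    then have "real (K choose m) = 0" by (simp add: binomial_eq_0)
    moreover have "0 \<le> 1 - m / M" using assms by (simp add: divide_le_eq)
    ultimately show ?thesis by (simp only: zero_le_mult_iff of_nat_0_le_iff) simp
  qed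
  also have "\<dots> \<le> (1 - m / M) * ((1 - m / M) ^ a * real (M choose m))"
    using Suc K assms by (intro mult_left_mono) (auto simp: divide_le_eq)
  finally show ?case by (simp add: K_def mult_ac)
qed simp

lemma power_one_minus_le_exp:
  fixes x :: real assumes "x \<le> 1" shows "(1 - x) ^ n \<le> exp (- (n * x))"
proof -
  have "(1 - x) ^ n \<le> exp (- x) ^ n"
    using assms exp_ge_add_one_self[of "- x"] by (intro power_mono) auto
  then show ?thesis by (simp add: exp_of_nat_mult[symmetric])
qed

subsection \<open>Shattered sets\<close>

definition shattered :: "'a set set \<Rightarrow> 'a set \<Rightarrow> bool" where
  "shattered \<F> Y \<longleftrightarrow> (\<forall>Z\<subseteq>Y. \<exists>A\<in>\<F>. A \<inter> Y = Z)"

text \<open>Pajor's form of the Sauer-Shelah lemma. \<open>\<F>0\<close> consists of the traces on X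
  and \<open>\<F>1\<close> of those that occur both with and without x, so their sizes add up to
  that of \<open>\<F>\<close>. A set shattered by \<open>\<F>1\<close> remains shattered by
  \<open>\<F>\<close> after x is adjoined, while sets shattered by \<open>\<F>0\<close> avoid x;
  hence nothing is counted twice.\<close>

lemma card_le_card_shattered:
  assumes "finite X" "\<F> \<subseteq> Pow X"
  shows "card \<F> \<le> card {Y. Y \<subseteq> X \<and> shattered \<F> Y}"
  using assms
proof (induction X arbitrary: \<F> rule: finite_induct)
  case empty
  then consider "\<F> = {}" | "\<F> = {{}}" by auto
  then show ?case
  proof cases
    case 2
    then have "{Y. Y \<subseteq> {} \<and> shattered \<F> Y} = {{}}" by (auto simp: shattered_def)
    then show ?thesis using 2 by simp
  qed simp
next
  case (insert x X)
  define \<F>0 where "\<F>0 = (\<lambda>A. A - {x}) ` \<F>"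
  define \<F>1 where "\<F>1 = {A. A \<in> \<F> \<and> x \<notin> A \<and> insert x A \<in> \<F>}"
  have fin: "finite \<F>"
    by (rule finite_subset[OF insert.prems]) (use insert.hyps in simp)
  have sub: "\<F>0 \<subseteq> Pow X" "\<F>1 \<subseteq> Pow X"
    using insert.prems by (auto simp: \<F>0_def \<F>1_def)
  have split: "card \<F> = card \<F>0 + card \<F>1"
  proof -
    let ?U = "{A\<in>\<F>. x \<notin> A}" and ?V = "(\<lambda>A. A - {x}) ` {A\<in>\<F>. x \<in> A}"
    have inj: "inj_on (\<lambda>A. A - {x}) {A\<in>\<F>. x \<in> A}"
      by (rule inj_onI) (metis (mono_tags, lifting) insert_Diff mem_Collect_eq)
    have "card (?U \<union> {A\<in>\<F>. x \<in> A}) = card ?U + card {A\<in>\<F>. x \<in> A}"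
      using fin by (intro card_Un_disjoint) auto
    also have "?U \<union> {A\<in>\<F>. x \<in> A} = \<F>" by blast
    finally have "card \<F> = card ?U + card {A\<in>\<F>. x \<in> A}" .
    also have "card {A\<in>\<F>. x \<in> A} = card ?V" using inj by (simp add: card_image)
    also have "card ?U + card ?V = card (?U \<union> ?V) + card (?U \<inter> ?V)"
      using fin by (intro card_Un_Int) auto
    also have "?U \<union> ?V = \<F>0"
    proof -
      have "(\<lambda>A. A - {x}) ` ?U = id ` ?U" by (intro image_cong) auto
      then have "?U \<union> ?V = (\<lambda>A. A - {x}) ` (?U \<union> {A\<in>\<F>. x \<in> A})"
        by (simp only: image_Un image_id id_apply)
      also have "?U \<union> {A\<in>\<F>. x \<in> A} = \<F>" by blast
      finally show ?thesis by (simp only: \<F>0_def)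
    qed
    also have "?U \<inter> ?V = \<F>1"
    proof (rule set_eqI)
      fix A
      have "A \<in> ?V \<longleftrightarrow> insert x A \<in> \<F>" if "x \<notin> A"
        using that by (metis (no_types, lifting) Diff_insert_absorb image_iff insertI1 insert_Diff mem_Collect_eq)
      then show "A \<in> ?U \<inter> ?V \<longleftrightarrow> A \<in> \<F>1" unfolding \<F>1_def by blast
    qed
    finally show ?thesis .
  qed
  let ?S0 = "{Y. Y \<subseteq> X \<and> shattered \<F>0 Y}" and ?S1 = "{Y. Y \<subseteq> X \<and> shattered \<F>1 Y}"
  have finX: "finite ?S0" "finite ?S1" using insert.hyps by auto
  have inj: "inj_on (insert x) ?S1" using insert.hyps
    by (intro inj_onI) (metis (mono_tags, lifting) insert_ident mem_Collect_eq subsetD)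
  have 0: "shattered \<F> Y" if Y: "Y \<subseteq> X" "shattered \<F>0 Y" for Y
    unfolding shattered_def
  proof (intro allI impI)
    fix Z assume "Z \<subseteq> Y"
    then obtain A where "A \<in> \<F>" "(A - {x}) \<inter> Y = Z"
      using Y unfolding shattered_def \<F>0_def by blast
    moreover have "x \<notin> Y" using Y insert.hyps by auto
    ultimately show "\<exists>A\<in>\<F>. A \<inter> Y = Z" by blast
  qed
  have 1: "shattered \<F> (insert x Y)" if Y: "Y \<subseteq> X" "shattered \<F>1 Y" for Y
    unfolding shattered_def
  proof (intro allI impI)
    fix Z assume Z: "Z \<subseteq> insert x Y"
    then have "Z - {x} \<subseteq> Y" by auto
    then obtain A where A: "A \<in> \<F>" "x \<notin> A" "insert x A \<in> \<F>" "A \<inter> Y = Z - {x}"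
      using Y unfolding shattered_def \<F>1_def by blast
    have "x \<notin> Y" using Y insert.hyps by auto
    show "\<exists>A\<in>\<F>. A \<inter> insert x Y = Z"
    proof (cases "x \<in> Z")
      case True
      then have "insert x A \<inter> insert x Y = Z" using A by auto
      then show ?thesis using A by blast
    next
      case False
      then have "A \<inter> insert x Y = Z" using A by auto
      then show ?thesis using A by blast
    qed
  qed
  have "card \<F> \<le> card ?S0 + card ?S1"
    using split insert.IH[OF sub(1)] insert.IH[OF sub(2)] by simp
  also have "\<dots> = card ?S0 + card (insert x ` ?S1)" using inj by (simp add: card_image)
  also have "\<dots> = card (?S0 \<union> insert x ` ?S1)"
    using finX insert.hyps by (subst card_Un_disjoint) auto
  also have "\<dots> \<le> card {Y. Y \<subseteq> insert x X \<and> shattered \<F> Y}"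
    using insert.hyps 0 1 by (intro card_mono) auto
  finally show ?case .
qed

lemma card_small_subsets_le:
  assumes "finite X"
  shows "card {Y. Y \<subseteq> X \<and> card Y \<le> d} \<le> card X ^ d + 1"
proof -
  let ?P = "PiE {..<d} (\<lambda>_. X)"
  have fin: "finite ?P" using assms by (intro finite_PiE) auto
  have "{Y. Y \<subseteq> X \<and> card Y \<le> d} \<subseteq> insert {} ((\<lambda>c. c ` {..<d}) ` ?P)"
  proof
    fix Y assume "Y \<in> {Y. Y \<subseteq> X \<and> card Y \<le> d}"
    then have Y: "Y \<subseteq> X" "card Y \<le> d" by auto
    then have fY: "finite Y" using assms finite_subset by blast
    show "Y \<in> insert {} ((\<lambda>c. c ` {..<d}) ` ?P)"
    proof (cases "Y = {}")
      case False
      then obtain y where y: "y \<in> Y" by blast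
      obtain e where e: "bij_betw e {0..<card Y} Y" using ex_bij_betw_nat_finite[OF fY] by blast
      \<comment> \<open>An enumeration of Y, filled up to d places by repeating y. The padding needs
        an element, so the empty set is counted apart, by the + 1.\<close>
      define c where "c = restrict (\<lambda>i. if i < card Y then e i else y) {..<d}"
      have "c ` {..<d} = Y"
      proof -
        have "e ` {0..<card Y} = Y" using e by (simp add: bij_betw_def)
        moreover have "c ` {0..<card Y} = e ` {0..<card Y}"
          using Y by (intro image_cong) (auto simp: c_def)
        moreover have "c ` {card Y..<d} \<subseteq> {y}" by (auto simp: c_def)
        moreover have "{..<d} = {0..<card Y} \<union> {card Y..<d}" using Y by auto
        ultimately show ?thesis using y by (auto simp: image_Un)
      qed
      moreover from this have "c \<in> ?P"
        using Y by (auto simp: PiE_iff c_def)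
      ultimately show ?thesis by blast
    qed simp
  qed
  then have "card {Y. Y \<subseteq> X \<and> card Y \<le> d} \<le> card (insert {} ((\<lambda>c. c ` {..<d}) ` ?P))"
    using fin by (intro card_mono) auto
  also have "\<dots> \<le> card ((\<lambda>c. c ` {..<d}) ` ?P) + 1"
    by (simp add: card_insert_le_m1 card_insert_if fin)
  also have "\<dots> \<le> card ?P + 1" using fin card_image_le by auto
  finally show ?thesis by (simp add: card_PiE)
qed

subsection \<open>Linear separation\<close>

lemma ex_pos_perturbation:
  fixes a b :: "'a \<Rightarrow> real"
  assumes "finite A" "\<And>w. w \<in> A \<Longrightarrow> a w > 0"
  shows "\<exists>e>0. \<forall>w\<in>A. a w + e * b w > 0"
proof -
  have "\<forall>\<^sub>F e in at_right 0. \<forall>w\<in>A. a w + e * b w > 0"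
  proof (intro eventually_ball_finite[OF assms(1)] ballI)
    fix w assume "w \<in> A"
    have "((\<lambda>e. a w + e * b w) \<longlongrightarrow> a w + 0 * b w) (at_right 0)"
      by (intro tendsto_intros)
    then show "\<forall>\<^sub>F e in at_right 0. a w + e * b w > 0"
      using assms(2)[OF \<open>w \<in> A\<close>] by (intro order_tendstoD(1)[where a = 0]) auto
  qed
  moreover have "\<forall>\<^sub>F e in at_right 0. (0::real) < e"
    by (rule eventually_at_right_less)
  ultimately have "\<forall>\<^sub>F e in at_right 0. (0::real) < e \<and> (\<forall>w\<in>A. a w + e * b w > 0)"
    by eventually_elim auto
  then show ?thesis
    using eventually_happens[of _ "at_right (0::real)"] by (auto simp: trivial_limit_at_right_real)
qed

lemma convex_linear_gt: "linear f \<Longrightarrow> convex {x. f x > (c::real)}"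
  using convex_linear_vimage[of f "{c<..}"] by (simp add: vimage_def)

lemma convex_linear_less: "linear f \<Longrightarrow> convex {x. f x < (c::real)}"
  using convex_linear_vimage[of f "{..<c}"] by (simp add: vimage_def)

text \<open>A theorem of the alternative, proved algebraically by projecting along one point v. If 0
  is not in the hull of the projections, a functional positive on them vanishes at v, and a small
  multiple of \<open>g\<close> repairs this. Otherwise the hull of \<open>W'\<close> contains a
  multiple y of v: a positive factor makes \<open>f0\<close> positive at v as well, a negative one
  puts 0 on the segment from y to v.\<close>

lemma zero_in_convex_hull_or_linear_pos:
  fixes W :: "'a::real_vector set"
  assumes "finite W" "0 \<notin> convex hull W"
  shows "\<exists>f. linear f \<and> (\<forall>w\<in>W. f w > (0::real))"
  using assms
proof (induction "card W" arbitrary: W rule: less_induct)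
  case less
  show ?case
  proof (cases "W = {}")
    case True
    then show ?thesis by (auto intro!: exI[of _ "\<lambda>_. 0"] linearI)
  next
    case False
    then obtain v where v: "v \<in> W" by blast
    define W' where "W' = W - {v}"
    have W: "W = insert v W'" "finite W'" "card W' < card W"
      using v less.prems card_Diff1_less[of W v] by (auto simp: W'_def)
    have hull: "convex hull W' \<subseteq> convex hull W" by (simp add: W(1) hull_mono subset_insertI)
    have "v \<noteq> 0" using v less.prems by (metis hull_inc)
    then have "independent {v}" by simp
    then obtain g :: "'a \<Rightarrow> real" where g: "linear g" "g v = 1"
      using linear_independent_extend[of "{v}" "\<lambda>_. 1"] by auto
    interpret g: linear g by fact
    obtain f0 where f0: "linear f0" "\<forall>w\<in>W'. f0 w > (0::real)"
      using less.hyps[OF W(3)] W(2) less.prems hull by auto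
    interpret f0: linear f0 by fact
    define p where "p x = x - g x *\<^sub>R v" for x
    have p: "linear p"
      by (rule linearI) (simp_all add: p_def g.add g.scale algebra_simps)
    have card: "card (p ` W') < card W" using W by (meson card_image_le le_less_trans)
    show ?thesis
    proof (cases "0 \<in> convex hull (p ` W')")
      case False
      then obtain f where f: "linear f" "\<forall>w\<in>W'. f (p w) > (0::real)"
        using less.hyps[OF card] W(2) by auto
      interpret f: linear f by fact
      obtain e where e: "e > 0" "\<forall>w\<in>W'. f (p w) + e * g w > 0"
        using ex_pos_perturbation[of W' "\<lambda>w. f (p w)" g] W(2) f by auto
      have "linear (\<lambda>x. f (p x) + e * g x)"
      proof -
        interpret p: linear p by fact
        show ?thesis
          by (rule linearI) (simp_all add: p.add p.scale f.add f.scale g.add g.scale algebra_simps)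
      qed
      moreover have "p v = 0" by (simp add: p_def g)
      ultimately show ?thesis using e g W(1) by (intro exI[of _ "\<lambda>x. f (p x) + e * g x"]) (auto simp: f.zero)
    next
      case True
      then obtain y where y: "y \<in> convex hull W'" "p y = 0"
        by (metis convex_hull_linear_image[OF p] imageE)
      then have yv: "y = g y *\<^sub>R v" by (simp add: p_def)
      have "convex hull W' \<subseteq> {x. f0 x > 0}"
        using f0 by (intro hull_minimal convex_linear_gt) auto
      then have pos: "0 < g y * f0 v" using y(1) yv f0.scale by (metis mem_Collect_eq real_scaleR_def subsetD)
      show ?thesis
      proof (cases "g y > 0")
        case True
        then have "f0 v > 0" using pos by (simp add: zero_less_mult_iff)
        then show ?thesis using f0 W(1) by auto
      next
        case False
        then have neg: "g y < 0" using pos by (auto simp: zero_less_mult_iff)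
        \<comment> \<open>The weight for which the convex combination of y and v vanishes, y being
          \<open>g y\<close> times v.\<close>
        define t where "t = 1 / (1 - g y)"
        have t: "0 \<le> t" "0 \<le> 1 - t" "t * g y + (1 - t) = 0"
          using neg by (auto simp: t_def field_simps)
        have "t *\<^sub>R y + (1 - t) *\<^sub>R v = (t * g y + (1 - t)) *\<^sub>R v"
          by (subst yv) (simp add: algebra_simps)
        also have "\<dots> = 0" using t by simp
        finally have "t *\<^sub>R y + (1 - t) *\<^sub>R v = 0" .
        moreover have "t *\<^sub>R y + (1 - t) *\<^sub>R v \<in> convex hull W"
          using y(1) hull v t by (intro convexD) (auto simp: hull_inc)
        ultimately show ?thesis using less.prems by simp
      qed
    qed
  qed
qed

lemma not_in_convex_hull_imp_linear_less:
  fixes W :: "'a::real_vector set"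
  assumes "finite W" "b \<notin> convex hull W"
  shows "\<exists>f. linear f \<and> (\<forall>w\<in>W. f w < (f b :: real))"
proof -
  have "convex hull ((\<lambda>w. b - w) ` W) = (\<lambda>w. b - w) ` (convex hull W)"
  proof -
    have "(\<lambda>w. b - w) ` S = (+) b ` (uminus ` S)" for S by (auto simp: image_image)
    moreover have "linear (uminus :: 'a \<Rightarrow> 'a)" by (rule linearI) auto
    ultimately show ?thesis by (simp add: convex_hull_translation convex_hull_linear_image)
  qed
  then have "0 \<notin> convex hull ((\<lambda>w. b - w) ` W)" using assms by auto
  then obtain f where f: "linear f" "\<forall>w\<in>W. f (b - w) > (0::real)"
    using zero_in_convex_hull_or_linear_pos[of "(\<lambda>w. b - w) ` W"] assms by auto
  then show ?thesis by (auto simp: linear_diff)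
qed

text \<open>Shattering Y forces the differences y - b to be independent, so the dimension bounds the
  size of Y. For a nontrivial linear relation with coefficients u, a half-space selecting exactly
  the points with u nonnegative would make every \<open>u v * f v\<close> nonnegative and one of
  them positive, although these products add up to f 0 = 0.\<close>

lemma card_halfspace_traces_le:
  fixes X E :: "'a::real_vector set"
  assumes "finite X" "finite E" "X \<subseteq> span E" "b \<in> span E"
  shows "card {A. \<exists>f. linear f \<and> A = {x\<in>X. f x \<ge> (f b :: real)}} \<le> card X ^ card E + 1"
proof -
  let ?F = "{A. \<exists>f. linear f \<and> A = {x\<in>X. f x \<ge> (f b :: real)}}"
  have "card Y \<le> card E" if Y: "Y \<subseteq> X" "shattered ?F Y" for Y
  proof -
    let ?Y = "(\<lambda>y. y - b) ` Y"
    have "independent ?Y"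
    proof
      assume "dependent ?Y"
      then obtain t u where t: "finite t" "t \<subseteq> ?Y" "(\<Sum>v\<in>t. u v *\<^sub>R v) = 0" "\<exists>v\<in>t. u v \<noteq> 0"
        unfolding dependent_explicit by blast
      \<comment> \<open>The half-spaces are closed, so only a negative coefficient leads to a strict
        sign of f; flipping all signs provides one if necessary.\<close>
      obtain u where u: "(\<Sum>v\<in>t. u v *\<^sub>R v) = 0" "\<exists>v\<in>t. u v < 0"
      proof (cases "\<exists>v\<in>t. u v < 0")
        case False
        then have "\<exists>v\<in>t. - u v < 0" using t(4) by force
        moreover have "(\<Sum>v\<in>t. (- u v) *\<^sub>R v) = 0" using t(3) by (simp add: sum_negf)
        ultimately show ?thesis using that[of "\<lambda>v. - u v"] by blast
      qed (use t(3) that in blast)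
      have "{y\<in>Y. u (y - b) \<ge> 0} \<subseteq> Y" by auto
      then obtain A where A: "A \<in> ?F" "A \<inter> Y = {y\<in>Y. u (y - b) \<ge> 0}"
        using Y(2)[unfolded shattered_def, rule_format] by meson
      then obtain f where f: "linear f" "A = {x\<in>X. f x \<ge> (f b :: real)}" by blast
      interpret f: linear f by fact
      have iff: "f v \<ge> 0 \<longleftrightarrow> u v \<ge> 0" if v: "v \<in> t" for v
      proof -
        obtain y where y: "y \<in> Y" "v = y - b" using t(2) v by blast
        have "y \<in> A \<longleftrightarrow> f v \<ge> 0" using y Y(1) f by (auto simp: f.diff)
        moreover have "y \<in> A \<longleftrightarrow> u v \<ge> 0" using A(2) y by blast
        ultimately show ?thesis by simp
      qed
      have "0 < (\<Sum>v\<in>t. u v * f v)"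
      proof -
        obtain v where v: "v \<in> t" "u v < 0" using u(2) by blast
        have "u v * f v > 0" using v iff[of v] by (simp add: mult_neg_neg)
        moreover have "u w * f w \<ge> 0" if "w \<in> t" for w
          using iff[OF that] by (cases "u w \<ge> 0") (auto intro: mult_nonpos_nonpos)
        ultimately show ?thesis using t(1) v by (intro sum_pos2[of t v]) auto
      qed
      also have "\<dots> = f (\<Sum>v\<in>t. u v *\<^sub>R v)" by (simp add: f.sum f.scale)
      finally show False using u(1) by (simp add: f.zero)
    qed
    moreover have "?Y \<subseteq> span E" using Y(1) assms by (auto intro: span_diff)
    ultimately have "card ?Y \<le> card E" using independent_span_bound[OF assms(2)] by blast
    then show ?thesis by (simp add: card_image inj_on_def)
  qed
  then have sub: "{Y. Y \<subseteq> X \<and> shattered ?F Y} \<subseteq> {Y. Y \<subseteq> X \<and> card Y \<le> card E}" by blast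
  have "card ?F \<le> card {Y. Y \<subseteq> X \<and> shattered ?F Y}"
    using assms(1) by (intro card_le_card_shattered) auto
  also have "\<dots> \<le> card {Y. Y \<subseteq> X \<and> card Y \<le> card E}"
    using sub assms(1) by (intro card_mono) auto
  also have "\<dots> \<le> card X ^ card E + 1" using assms(1) by (rule card_small_subsets_le)
  finally show ?thesis .
qed

subsection \<open>Faces of convex hulls\<close>

text \<open>The points satisfying the implication in \<open>?C\<close> form a convex set containing
  W: if a proper combination of two of them lies in F, the face property puts both into F.\<close>

lemma face_of_convex_hull_eq:
  assumes F: "F face_of convex hull W"
  shows "F = convex hull (F \<inter> W)"
proof
  show "convex hull (F \<inter> W) \<subseteq> F"
    using face_of_imp_convex[OF F] by (simp add: hull_minimal)
  let ?C = "{x \<in> convex hull W. x \<in> F \<longrightarrow> x \<in> convex hull (F \<inter> W)}"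
  have "convex ?C"
  proof (rule convexI)
    fix x y and u v :: real
    assume x: "x \<in> ?C" and y: "y \<in> ?C" and uv: "0 \<le> u" "0 \<le> v" "u + v = 1"
    let ?z = "u *\<^sub>R x + v *\<^sub>R y"
    have z: "?z \<in> convex hull W" using x y uv by (intro convexD) auto
    have "?z \<in> convex hull (F \<inter> W)" if zF: "?z \<in> F"
    proof (cases "u = 0 \<or> v = 0 \<or> x = y")
      case True
      then have "?z = x \<or> ?z = y"
        using uv by (elim disjE) (simp_all flip: scaleR_left.add)
      then show ?thesis using x y zF by auto
    next
      case False
      then have "x \<noteq> y" "0 < v" "v < 1" "u = 1 - v" using uv by auto
      then have "?z \<in> open_segment x y" unfolding in_segment by metis
      then have "x \<in> F" "y \<in> F" using face_ofD[OF F] x y zF by blast+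
      then show ?thesis using x y uv by (intro convexD) auto
    qed
    then show "?z \<in> ?C" using z by blast
  qed
  then have "convex hull W \<subseteq> ?C" by (intro hull_minimal) (auto simp: hull_inc)
  then show "F \<subseteq> convex hull (F \<inter> W)" using face_of_imp_subset[OF F] by blast
qed

lemma finite_faces_convex_hull: "finite W \<Longrightarrow> finite {F. F face_of convex hull W}"
proof (rule finite_subset)
  show "{F. F face_of convex hull W} \<subseteq> (hull) convex ` Pow W"
    using face_of_convex_hull_eq by blast
qed simp

text \<open>This is what makes a spanning subset determine its face. For x in F, the segment from x
  is extended slightly beyond the barycenter b of S. As x is an affine combination of S, the new end
  y is still in the hull of S. Then b is an inner point of a segment in Q and lies in the face
  \<open>F'\<close>, which therefore contains x.\<close>

lemma face_of_subset_face:
  assumes Q: "convex Q" and F: "F face_of Q" and F': "F' face_of Q"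
    and S: "finite S" "S \<noteq> {}" "S \<subseteq> F'" "F \<subseteq> affine hull S"
  shows "F \<subseteq> F'"
proof
  fix x assume x: "x \<in> F"
  then obtain u where u: "sum u S = 1" "(\<Sum>s\<in>S. u s *\<^sub>R s) = x"
    using S affine_hull_finite[OF S(1)] by auto
  define r where "r = 1 / real (card S)"
  have r: "r > 0" "card S * r = 1" using S by (auto simp: r_def card_gt_0_iff)
  define b where "b = (\<Sum>s\<in>S. r *\<^sub>R s)"
  have hull: "convex hull S \<subseteq> F'" using face_of_imp_convex[OF F'] S by (simp add: hull_minimal)
  have b: "b \<in> F'"
    using hull S(1) r unfolding convex_hull_finite[OF S(1)] b_def
    by (intro subsetD[OF hull[unfolded convex_hull_finite[OF S(1)]]]) (auto intro!: exI[of _ "\<lambda>_. r"])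
  \<comment> \<open>The coefficients of b + e (b - x) with respect to S; they are positive for small
    e because r > 0.\<close>
  obtain e where e: "e > 0" "\<forall>s\<in>S. r + e * (r - u s) > 0"
    using ex_pos_perturbation[of S "\<lambda>_. r" "\<lambda>s. r - u s"] S r by auto
  define y where "y = (\<Sum>s\<in>S. (r + e * (r - u s)) *\<^sub>R s)"
  have "(\<Sum>s\<in>S. r + e * (r - u s)) = 1"
    using r u by (simp add: sum.distrib sum_subtractf flip: sum_distrib_left)
  then have "y \<in> convex hull S"
    using e S(1) unfolding convex_hull_finite[OF S(1)] y_def
    by (auto intro!: exI[of _ "\<lambda>s. r + e * (r - u s)"] less_imp_le)
  then have y: "y \<in> F'" using hull by blast
  have yb: "y = b + e *\<^sub>R (b - x)"
    by (simp add: y_def b_def u(2)[symmetric] algebra_simps sum.distrib sum_subtractf scaleR_sum_right)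
  show "x \<in> F'"
  proof (cases "x = b")
    case False
    have beq: "b = (1 - 1 / (1 + e)) *\<^sub>R x + (1 / (1 + e)) *\<^sub>R y"
    proof -
      have "(1 + e) *\<^sub>R b = e *\<^sub>R x + y" by (simp add: yb algebra_simps)
      then have "(1 / (1 + e)) *\<^sub>R ((1 + e) *\<^sub>R b) = (1 / (1 + e)) *\<^sub>R (e *\<^sub>R x + y)" by simp
      moreover have "1 - 1 / (1 + e) = e / (1 + e)" using e by (simp add: field_simps)
      ultimately show ?thesis using e by (simp add: scaleR_right_distrib)
    qed
    have "x \<noteq> y"
    proof
      assume "x = y"
      then have "(1 + e) *\<^sub>R (x - b) = 0" using yb by (simp add: algebra_simps)
      then show False using False e by simp
    qed
    then have "b \<in> open_segment x y"
      using e beq by (auto simp: in_segment intro!: exI[of _ "1 / (1 + e)"])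
    then show ?thesis
      using face_ofD[OF F'] x y b face_of_imp_subset[OF F] face_of_imp_subset[OF F'] by blast
  qed (use b in simp)
qed

lemma affine_independent_card_le:
  fixes B B' :: "'a::real_vector set"
  assumes B: "finite B" and B': "\<not> affine_dependent B'" "B' \<subseteq> affine hull B"
  shows "finite B' \<and> card B' \<le> card B"
proof (cases "B' = {}")
  case False
  then have "B \<noteq> {}" using B' by auto
  then obtain a where a: "a \<in> B" by blast
  obtain a' where a': "a' \<in> B'" using False by blast
  let ?T = "(\<lambda>x. - a + x) ` (B - {a})" and ?T' = "(\<lambda>x. - a' + x) ` (B' - {a'})"
  have "independent ?T'"
    using B' a' affine_dependent_iff_dependent[of a' "B' - {a'}"] by (simp add: insert_absorb)
  moreover have "?T' \<subseteq> span ?T"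
  proof -
    have *: "- a + x \<in> span ?T" if "x \<in> B'" for x
      using that B'(2) affine_hull_span2[OF a] by (auto simp: subset_iff)
    have "- a' + x = (- a + x) - (- a + a')" for x by simp
    then show ?thesis using * a' by (metis (no_types, lifting) DiffD1 image_subsetI span_diff)
  qed
  ultimately have "finite ?T'" "card ?T' \<le> card ?T"
    using independent_span_bound[of ?T ?T'] B by auto
  then have fin: "finite (B' - {a'})" and "card (B' - {a'}) \<le> card (B - {a})"
    by (simp_all add: card_image inj_on_def finite_image_iff)
  then show ?thesis using a a' B by (metis card_Suc_Diff1 finite_Diff_insert finite_Diff2 finite.emptyI finite.insertI Suc_le_mono)
qed simp

text \<open>This pins down the \<open>SOME\<close> in \<open>affine_dim\<close>. The exchange
  argument must also exclude infinite candidates, whose \<open>card\<close> would be 0.\<close>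

lemma affine_dim_eq_card:
  fixes B :: "'a::real_vector set"
  assumes "finite B" "\<not> affine_dependent B" "affine hull B = affine hull V"
  shows "affine_dim V = int (card B) - 1"
proof -
  have uniq: "card B' = card B" if "affine hull B' = affine hull V" "\<not> affine_dependent B'" for B'
  proof -
    have *: "finite B' \<and> card B' \<le> card B"
      using affine_independent_card_le[of B B'] assms that by (metis hull_subset)
    moreover have "card B \<le> card B'"
      using affine_independent_card_le[of B' B] assms that * by (metis hull_subset)
    ultimately show ?thesis by simp
  qed
  have "(\<exists>B. affine hull B = affine hull V \<and> \<not> affine_dependent B \<and> of_nat (card B) = d + 1)
      \<longleftrightarrow> d = int (card B) - 1" for d :: int
  proof
    assume "d = int (card B) - 1"
    then show "\<exists>B. affine hull B = affine hull V \<and> \<not> affine_dependent B \<and> of_nat (card B) = d + 1"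
      using assms by (intro exI[of _ B]) auto
  qed (use uniq in force)
  then show ?thesis unfolding affine_dim_def by simp
qed

lemma face_spanning_subset:
  fixes W :: "'a::real_vector set"
  assumes "finite W" "F face_of convex hull W" "affine_dim F = int k"
  shows "\<exists>S. S \<subseteq> F \<inter> W \<and> card S = k + 1 \<and> affine hull S = affine hull F"
proof -
  obtain B where B: "B \<subseteq> F \<inter> W" "\<not> affine_dependent B" "affine hull (F \<inter> W) = affine hull B"
    using affine_basis_exists by blast
  have hull: "affine hull B = affine hull F"
    by (metis B(3) affine_hull_convex_hull assms(2) face_of_convex_hull_eq)
  have "finite B" using B(1) assms(1) by (meson finite_Int finite_subset)
  then have "affine_dim F = int (card B) - 1"
    using B hull by (intro affine_dim_eq_card) auto
  then show ?thesis using B(1) hull assms(3) by (intro exI[of _ B]) auto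
qed

text \<open>Each k-face is charged to k + 1 points of W that span it affinely; by
  \<open>face_of_subset_face\<close> no subset is charged twice.\<close>

lemma num_faces_convex_hull_le:
  fixes W :: "'a::real_vector set"
  assumes "finite W"
  shows "num_faces k (convex hull W) \<le> card {S. S \<subseteq> W \<and> card S = k + 1 \<and>
    (\<exists>F. F face_of convex hull W \<and> S \<subseteq> F \<and> F \<subseteq> affine hull S)}"
    (is "_ \<le> card ?R")
proof -
  let ?F = "{F. F face_of convex hull W \<and> affine_dim F = int k}"
  define h where "h F = (SOME S. S \<subseteq> F \<inter> W \<and> card S = k + 1 \<and> affine hull S = affine hull F)" for F
  have h: "h F \<subseteq> F \<inter> W \<and> card (h F) = k + 1 \<and> affine hull (h F) = affine hull F" if "F \<in> ?F" for F
  proof -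
    have "\<exists>S. S \<subseteq> F \<inter> W \<and> card S = k + 1 \<and> affine hull S = affine hull F"
      using that face_spanning_subset[OF assms] by blast
    then show ?thesis unfolding h_def by (rule someI_ex)
  qed
  have sub: "F \<subseteq> F'" if "F \<in> ?F" "F' \<in> ?F" "h F = h F'" for F F'
  proof (rule face_of_subset_face[where Q = "convex hull W" and S = "h F"])
    have "card (h F) = k + 1" using h[OF that(1)] by blast
    then show "finite (h F)" "h F \<noteq> {}" by (auto intro: card_ge_0_finite)
    show "h F \<subseteq> F'" using h[OF that(2)] that(3) by auto
    show "F \<subseteq> affine hull (h F)" using h[OF that(1)] hull_subset[of F affine] by metis
  qed (use that in auto)
  have "inj_on h ?F"
  proof (rule inj_onI)
    fix F F' assume *: "F \<in> ?F" "F' \<in> ?F" "h F = h F'"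
    show "F = F'" by (rule subset_antisym[OF sub[OF *] sub[OF *(2,1) *(3)[symmetric]]])
  qed
  moreover have "h ` ?F \<subseteq> ?R"
  proof
    fix S assume "S \<in> h ` ?F"
    then obtain F where F: "F \<in> ?F" "S = h F" by blast
    have "F \<subseteq> affine hull (h F)" using h[OF F(1)] hull_subset[of F affine] by metis
    then show "S \<in> ?R" using F h[OF F(1)] by blast
  qed
  moreover have "finite ?R" using assms by simp
  ultimately show ?thesis unfolding num_faces_def by (rule card_inj_on_le)
qed

section \<open>Polytopes with vertices in the cube\<close>

lemma cube01_iff: "x \<in> cube01 d \<longleftrightarrow> (\<forall>i. x i \<in> {0, 1}) \<and> (\<forall>i\<ge>d. x i = 0)"
  unfolding cube01_def topspace_Euclidean_space by (auto simp: not_less) (metis not_less)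

lemma sum_apply_fun: "(\<Sum>i\<in>A. f i) x = (\<Sum>i\<in>A. f i x)"
  for f :: "'i \<Rightarrow> 'a \<Rightarrow> 'b::comm_monoid_add"
  by (induction A rule: infinite_finite_induct) auto

lemma linear_weighted_sum: "linear (\<lambda>x :: nat \<Rightarrow> real. \<Sum>j\<in>A. w j * x j)"
  by (rule linearI) (simp_all add: sum.distrib sum_distrib_left algebra_simps)

lemma span_unit_vectors:
  fixes x :: "nat \<Rightarrow> real"
  assumes "\<And>i. i \<ge> d \<Longrightarrow> x i = 0"
  shows "x \<in> span ((\<lambda>j i. if i = j then 1 else 0) ` {..<d})"
proof -
  have "x = (\<Sum>j<d. x j *\<^sub>R (\<lambda>i. if i = j then 1 else 0))"
  proof
    fix i
    have "(\<Sum>j<d. x j *\<^sub>R (\<lambda>i. if i = j then 1 else 0)) i = (\<Sum>j<d. if j = i then x j else 0)"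
      unfolding sum_apply_fun by (intro sum.cong) auto
    also have "\<dots> = x i" using assms by (subst sum.delta) (auto simp: not_less)
    finally show "x i = (\<Sum>j<d. x j *\<^sub>R (\<lambda>i. if i = j then 1 else 0)) i" by simp
  qed
  also have "\<dots> \<in> span ((\<lambda>j i. if i = j then 1 else 0) ` {..<d})"
    by (intro span_sum span_scale span_base) auto
  finally show ?thesis .
qed

text \<open>The functional with coefficients 1 where v is 1 and -1 where v is 0 attains its maximum
  over the cube only at v.\<close>

lemma not_in_convex_hull_cube01:
  assumes "W \<subseteq> cube01 d" "v \<in> cube01 d" "v \<notin> W"
  shows "v \<notin> convex hull W"
proof -
  define f where "f x = (\<Sum>j<d. (2 * v j - 1) * x j)" for x :: "nat \<Rightarrow> real"
  have lin: "linear f" unfolding f_def by (rule linear_weighted_sum)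
  have "f w < f v" if "w \<in> W" for w
  proof -
    have w: "w \<in> cube01 d" "w \<noteq> v" using that assms by auto
    have le: "(2 * v j - 1) * w j \<le> (2 * v j - 1) * v j" for j
    proof -
      have "w j = 0 \<or> w j = 1" "v j = 0 \<or> v j = 1" using w(1) assms(2) by (auto simp: cube01_iff)
      then show ?thesis by auto
    qed
    obtain j where j: "w j \<noteq> v j" using w(2) by auto
    then have "j < d" using w(1) assms(2) unfolding cube01_iff by (metis not_less)
    moreover have "(2 * v j - 1) * w j < (2 * v j - 1) * v j"
    proof -
      have "w j = 0 \<or> w j = 1" "v j = 0 \<or> v j = 1" using w(1) assms(2) by (auto simp: cube01_iff)
      then show ?thesis using j by auto
    qed
    ultimately show ?thesis unfolding f_def using le by (intro sum_strict_mono_ex1) auto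
  qed
  then have "convex hull W \<subseteq> {x. f x < f v}"
    by (intro hull_minimal convex_linear_less lin) auto
  then show ?thesis by auto
qed

lemma extreme_points_convex_hull_cube01:
  assumes "W \<subseteq> cube01 d"
  shows "{v. v extreme_point_of convex hull W} = W"
proof
  show "W \<subseteq> {v. v extreme_point_of convex hull W}"
  proof
    fix v assume v: "v \<in> W"
    have "finite (W - {v})" using assms finite_cube01 finite_subset by blast
    moreover have "v \<notin> convex hull (W - {v})"
      using assms v by (intro not_in_convex_hull_cube01[of _ d]) auto
    ultimately have "v extreme_point_of convex hull (insert v (W - {v}))"
      by (rule extreme_point_of_convex_hull_insert)
    then show "v \<in> {v. v extreme_point_of convex hull W}" using v by (simp add: insert_absorb)
  qed
qed (auto intro: extreme_point_of_convex_hull)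

lemma num_vertices_convex_hull_cube01:
  "W \<subseteq> cube01 d \<Longrightarrow> num_vertices (convex hull W) = card W"
  unfolding num_vertices_def by (simp add: extreme_points_convex_hull_cube01)

text \<open>The hull of S determines S as its set of extreme points, so different S yield different
  faces.\<close>

lemma num_faces_convex_hull_cube01_ge:
  assumes "W \<subseteq> cube01 d"
  shows "card {S. S \<subseteq> W \<and> card S = k + 1 \<and> \<not> affine_dependent S \<and> convex hull S face_of convex hull W}
    \<le> num_faces k (convex hull W)"
    (is "card ?R \<le> _")
proof -
  have fin: "finite W" using assms finite_cube01 finite_subset by blast
  have "inj_on ((hull) convex) ?R"
  proof (rule inj_onI)
    fix S S' assume "S \<in> ?R" "S' \<in> ?R" "convex hull S = convex hull S'"
    moreover from this have "S \<subseteq> cube01 d" "S' \<subseteq> cube01 d" using assms by auto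
    ultimately show "S = S'" by (metis extreme_points_convex_hull_cube01)
  qed
  moreover have "(hull) convex ` ?R \<subseteq> {F. F face_of convex hull W \<and> affine_dim F = int k}"
  proof -
    have "affine_dim (convex hull S) = int k" if "S \<in> ?R" for S
      using that affine_dim_eq_card[of S "convex hull S"] fin finite_subset by auto
    then show ?thesis by blast
  qed
  moreover have "finite {F. F face_of convex hull W \<and> affine_dim F = int k}"
    using finite_faces_convex_hull[OF fin] by (rule rev_finite_subset) auto
  ultimately show ?thesis unfolding num_faces_def by (rule card_inj_on_le)
qed

subsection \<open>Double counting\<close>

lemma card_supersets_avoiding:
  assumes "finite X" "S \<subseteq> X" "A \<subseteq> X - S" "card S \<le> n"
  shows "card {W. S \<subseteq> W \<and> W \<subseteq> X \<and> card W = n \<and> W \<inter> A = {}}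
    = (card X - card S - card A) choose (n - card S)"
proof -
  have fin: "finite S" "finite A" using assms finite_subset by blast+
  let ?V = "{V. V \<subseteq> X - S - A \<and> card V = n - card S}"
  have "card {W. S \<subseteq> W \<and> W \<subseteq> X \<and> card W = n \<and> W \<inter> A = {}} = card ?V"
  proof (rule bij_betw_same_card, rule bij_betw_byWitness[where f = "\<lambda>W. W - S" and f' = "\<lambda>V. V \<union> S"])
    show "(\<lambda>W. W - S) ` {W. S \<subseteq> W \<and> W \<subseteq> X \<and> card W = n \<and> W \<inter> A = {}} \<subseteq> ?V"
      using fin by (auto simp: card_Diff_subset)
    show "(\<lambda>V. V \<union> S) ` ?V \<subseteq> {W. S \<subseteq> W \<and> W \<subseteq> X \<and> card W = n \<and> W \<inter> A = {}}"
    proof clarify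
      fix V assume V: "V \<subseteq> X - S - A" "card V = n - card S"
      have "finite V" using V(1) assms(1) by (meson finite_Diff finite_subset)
      then have "card (V \<union> S) = card V + card S" using fin V(1) by (intro card_Un_disjoint) auto
      then show "S \<subseteq> V \<union> S \<and> V \<union> S \<subseteq> X \<and> card (V \<union> S) = n \<and> (V \<union> S) \<inter> A = {}"
        using V assms by auto
    qed
  qed auto
  also have "\<dots> = card (X - S - A) choose (n - card S)"
    using assms(1) by (intro n_subsets) auto
  also have "card (X - S - A) = card X - card S - card A"
    using assms fin by (simp add: card_Diff_subset)
  finally show ?thesis .
qed

lemma card_supersets:
  assumes "finite X" "S \<subseteq> X" "card S \<le> n"
  shows "card {W. S \<subseteq> W \<and> W \<subseteq> X \<and> card W = n} = (card X - card S) choose (n - card S)"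
  using card_supersets_avoiding[OF assms(1,2) empty_subsetI assms(3)] by simp

text \<open>Given that S lies in W, the other n - card S points form a uniform subset of X - S. The
  exponent is minus the expected number of them in A.\<close>

lemma card_supersets_avoiding_le:
  assumes X: "finite X" "S \<subseteq> X" "A \<subseteq> X - S" and n: "card S \<le> n" "n \<le> card X" "card S < card X"
  shows "real (card {W. S \<subseteq> W \<and> W \<subseteq> X \<and> card W = n \<and> W \<inter> A = {}})
    \<le> exp (- (real (card A) * (real (n - card S) / real (card X - card S))))
        * real ((card X - card S) choose (n - card S))"
proof -
  let ?M = "card X - card S" and ?m = "n - card S"
  have "card A \<le> card (X - S)" using X by (intro card_mono) auto
  also have "\<dots> = ?M" using X finite_subset by (intro card_Diff_subset) auto
  finally have "real ((?M - card A) choose ?m) \<le> (1 - ?m / ?M) ^ card A * real (?M choose ?m)"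
    using n by (intro binomial_diff_le) auto
  also have "\<dots> \<le> exp (- (card A * (?m / ?M))) * real (?M choose ?m)"
    using n by (intro mult_right_mono power_one_minus_le_exp) (auto simp: divide_le_eq)
  finally show ?thesis by (simp only: card_supersets_avoiding[OF X n(1)])
qed

text \<open>A union bound over A. With s and N the sizes of S and X, a fixed point of A belongs to W
  with conditional probability (n - s) / (N - s), which is at most n / N.\<close>

lemma card_supersets_hitting_le:
  assumes X: "finite X" "S \<subseteq> X" "A \<subseteq> X - S" and n: "card S \<le> n" "n \<le> card X"
  shows "real (card {W. S \<subseteq> W \<and> W \<subseteq> X \<and> card W = n \<and> W \<inter> A \<noteq> {}})
    \<le> card A * n / card X * real ((card X - card S) choose (n - card S))"
proof -
  let ?M = "card X - card S" and ?m = "n - card S"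
  have fin: "finite S" "finite A" using X finite_subset by blast+
  have one: "real (card {W. insert x S \<subseteq> W \<and> W \<subseteq> X \<and> card W = n}) \<le> n / card X * real (?M choose ?m)"
    if x: "x \<in> A" for x
  proof (cases "n = card S")
    \<comment> \<open>Truncated subtraction makes \<open>n - Suc (card S)\<close> equal to 0 here,
      and the binomial formula would count one set although there is none.\<close>
    case True
    have "card (insert x S) = Suc (card S)" using x X fin by (intro card_insert_disjoint) auto
    moreover have "card (insert x S) \<le> card W" if "insert x S \<subseteq> W" "W \<subseteq> X" for W
      using that X(1) by (intro card_mono) (auto intro: finite_subset)
    ultimately have "card W \<noteq> n" if "insert x S \<subseteq> W" "W \<subseteq> X" for W
      using that True Suc_n_not_le_n by metis
    then have "{W. insert x S \<subseteq> W \<and> W \<subseteq> X \<and> card W = n} = {}" by blast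
    then show ?thesis by (simp only: card.empty) simp
  next
    case False
    have c: "card (insert x S) = Suc (card S)" using x X fin by (intro card_insert_disjoint) auto
    have cnt: "card {W. insert x S \<subseteq> W \<and> W \<subseteq> X \<and> card W = n} = (card X - Suc (card S)) choose (n - Suc (card S))"
      using card_supersets[of X "insert x S" n] X x n False by (simp add: c) (metis DiffD1 subsetD)
    have M: "?M > 0" using n False by simp
    have absorb: "?m * (?M choose ?m) = ?M * ((card X - Suc (card S)) choose (n - Suc (card S)))"
      using times_binomial_minus1_eq[of ?m ?M] n False by simp
    have quot: "y = a / b * c" if "a * c = b * y" "b > 0" for a b c y :: real
      using that by (simp add: field_simps)
    have "real (card {W. insert x S \<subseteq> W \<and> W \<subseteq> X \<and> card W = n}) = ?m / ?M * real (?M choose ?m)"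
    proof (rule quot)
      show "real ?m * real (?M choose ?m) = real ?M * real (card {W. insert x S \<subseteq> W \<and> W \<subseteq> X \<and> card W = n})"
        by (simp only: cnt absorb flip: of_nat_mult)
    qed (use M in \<open>simp only: of_nat_0_less_iff\<close>)
    also have "\<dots> \<le> n / card X * real (?M choose ?m)"
    proof (rule mult_right_mono)
      have "real (card S) * real n \<le> real (card S) * real (card X)" using n by (intro mult_left_mono) auto
      then show "?m / ?M \<le> n / card X" using M n by (simp add: field_simps of_nat_diff)
    qed simp
    finally show ?thesis .
  qed
  have "{W. S \<subseteq> W \<and> W \<subseteq> X \<and> card W = n \<and> W \<inter> A \<noteq> {}}
      \<subseteq> (\<Union>x\<in>A. {W. insert x S \<subseteq> W \<and> W \<subseteq> X \<and> card W = n})" by auto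
  then have "card {W. S \<subseteq> W \<and> W \<subseteq> X \<and> card W = n \<and> W \<inter> A \<noteq> {}}
      \<le> card (\<Union>x\<in>A. {W. insert x S \<subseteq> W \<and> W \<subseteq> X \<and> card W = n})"
    using X(1) fin by (intro card_mono) (auto intro: finite_subset[of _ "Pow X"])
  also have "\<dots> \<le> (\<Sum>x\<in>A. card {W. insert x S \<subseteq> W \<and> W \<subseteq> X \<and> card W = n})"
    by (rule card_UN_le[OF fin(2)])
  finally have "real (card {W. S \<subseteq> W \<and> W \<subseteq> X \<and> card W = n \<and> W \<inter> A \<noteq> {}})
      \<le> (\<Sum>x\<in>A. real (card {W. insert x S \<subseteq> W \<and> W \<subseteq> X \<and> card W = n}))"
    by (simp flip: of_nat_sum)
  also have "\<dots> \<le> (\<Sum>x\<in>A. n / card X * real (?M choose ?m))"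
    by (intro sum_mono one)
  finally show ?thesis by simp
qed

text \<open>After division by the number C(N,n) C(n,r) of pairs, this is a union bound for a uniform
  pair S in W: either S is exceptional, or R has conditional probability at most p given S. Summing
  over S first is possible because C(N,n) C(n,r) = C(N,r) C(N-r,n-r).\<close>

lemma sum_card_pairs_le:
  fixes p :: real
  assumes X: "finite X" and r: "r \<le> n" "n \<le> card X" and p: "p \<ge> 0"
    and R: "\<And>S. S \<subseteq> X \<Longrightarrow> card S = r \<Longrightarrow> S \<notin> B \<Longrightarrow>
      real (card {W. S \<subseteq> W \<and> W \<subseteq> X \<and> card W = n \<and> R S W}) \<le> p * real ((card X - r) choose (n - r))"
  shows "(\<Sum>W\<in>{W. W \<subseteq> X \<and> card W = n}. real (card {S. S \<subseteq> W \<and> card S = r \<and> R S W}))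
    \<le> (real (card {S \<in> B. S \<subseteq> X \<and> card S = r}) / real (card X choose r) + p)
        * (real (card X choose n) * real (n choose r))"
proof -
  let ?C = "real ((card X - r) choose (n - r))"
  let ?Ws = "{W. W \<subseteq> X \<and> card W = n}" and ?Ss = "{S. S \<subseteq> X \<and> card S = r}"
  have fin: "finite ?Ws" "finite ?Ss" using X by auto
  have "(\<Sum>W\<in>?Ws. real (card {S. S \<subseteq> W \<and> card S = r \<and> R S W}))
      = (\<Sum>W\<in>?Ws. \<Sum>S | S \<in> ?Ss \<and> S \<subseteq> W \<and> R S W. 1)"
  proof (rule sum.cong)
    fix W assume "W \<in> ?Ws"
    then have "{S. S \<subseteq> W \<and> card S = r \<and> R S W} = {S \<in> ?Ss. S \<subseteq> W \<and> R S W}" by auto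
    then show "real (card {S. S \<subseteq> W \<and> card S = r \<and> R S W}) = (\<Sum>S | S \<in> ?Ss \<and> S \<subseteq> W \<and> R S W. 1)"
      by simp
  qed simp
  also have "\<dots> = (\<Sum>S\<in>?Ss. \<Sum>W | W \<in> ?Ws \<and> S \<subseteq> W \<and> R S W. 1)"
    by (rule sum.swap_restrict[OF fin])
  also have "\<dots> = (\<Sum>S\<in>?Ss. real (card {W. S \<subseteq> W \<and> W \<subseteq> X \<and> card W = n \<and> R S W}))"
    by (intro sum.cong) (auto intro!: arg_cong[where f = card])
  also have "\<dots> \<le> (\<Sum>S\<in>?Ss. (if S \<in> B then ?C else 0) + p * ?C)"
  proof (rule sum_mono)
    fix S assume S: "S \<in> ?Ss"
    show "real (card {W. S \<subseteq> W \<and> W \<subseteq> X \<and> card W = n \<and> R S W}) \<le> (if S \<in> B then ?C else 0) + p * ?C"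
    proof (cases "S \<in> B")
      case True
      have "card {W. S \<subseteq> W \<and> W \<subseteq> X \<and> card W = n \<and> R S W} \<le> card {W. S \<subseteq> W \<and> W \<subseteq> X \<and> card W = n}"
        using X by (intro card_mono) (auto intro: finite_subset[of _ "Pow X"])
      also have "\<dots> = (card X - r) choose (n - r)" using card_supersets[of X S n] X S r by auto
      finally have "real (card {W. S \<subseteq> W \<and> W \<subseteq> X \<and> card W = n \<and> R S W}) \<le> ?C" by simp
      moreover have "0 \<le> p * ?C" using p by simp
      ultimately show ?thesis using True by simp
    qed (use R S in auto)
  qed
  also have "\<dots> = (card {S\<in>?Ss. S \<in> B} + p * card ?Ss) * ?C"
    using fin by (simp add: sum.distrib algebra_simps flip: sum.inter_filter)
  also have "{S\<in>?Ss. S \<in> B} = {S \<in> B. S \<subseteq> X \<and> card S = r}" by auto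
  also have "card ?Ss = card X choose r" using X by (rule n_subsets)
  also have "(card {S \<in> B. S \<subseteq> X \<and> card S = r} + p * (card X choose r)) * ?C
    = (real (card {S \<in> B. S \<subseteq> X \<and> card S = r}) / real (card X choose r) + p)
        * (real (card X choose r) * ?C)"
  proof -
    have "real (card X choose r) > 0" using r by simp
    then show ?thesis by (simp add: field_simps)
  qed
  also have "real (card X choose r) * ?C = real (card X choose n) * real (n choose r)"
    using choose_mult[OF r] by (metis of_nat_mult)
  finally show ?thesis .
qed

subsection \<open>The expected face density\<close>

lemma expected_face_density_eq:
  assumes "m \<le> 2 ^ d"
  shows "expected_face_density k d m =
    (\<Sum>W\<in>{W. W \<subseteq> cube01 d \<and> card W = m}. real (num_faces k (convex hull W)))
      / (real (2 ^ d choose m) * real (m choose (k + 1)))"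
proof -
  let ?Ws = "{W. W \<subseteq> cube01 d \<and> card W = m}"
  have "expected_face_density k d m = (\<Sum>W\<in>?Ws. face_density k (convex hull W)) / real (card ?Ws)"
    unfolding expected_face_density_def random_subset_def
    by (rule integral_pmf_of_set[OF subsets_cube01_nonempty[OF assms] finite_subsets_cube01])
  also have "card ?Ws = 2 ^ d choose m"
    using n_subsets[OF finite_cube01] by (simp add: card_cube01)
  also have "(\<Sum>W\<in>?Ws. face_density k (convex hull W))
      = (\<Sum>W\<in>?Ws. real (num_faces k (convex hull W)) / real (m choose (k + 1)))"
    by (intro sum.cong) (auto simp: face_density_def num_vertices_convex_hull_cube01)
  finally show ?thesis by (simp add: sum_divide_distrib[symmetric] mult.commute)
qed

lemma expected_face_density_nonneg: "expected_face_density k d m \<ge> 0"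
  unfolding expected_face_density_def
  by (rule Bochner_Integration.integral_nonneg) (simp add: face_density_def)

lemma sum_binomial_subsets_cube01:
  "(\<Sum>W\<in>{W. W \<subseteq> cube01 d \<and> card W = m}. real (card {S. S \<subseteq> W \<and> card S = r}))
    = real (2 ^ d choose m) * real (m choose r)"
proof -
  have "card {S. S \<subseteq> W \<and> card S = r} = m choose r" if "W \<subseteq> cube01 d" "card W = m" for W
    using n_subsets[of W r] that finite_subset[OF _ finite_cube01] by auto
  then show ?thesis
    using n_subsets[OF finite_cube01, of d m] by (simp add: card_cube01)
qed

lemma expected_face_density_le_1:
  assumes "k + 1 \<le> m" "m \<le> 2 ^ d"
  shows "expected_face_density k d m \<le> 1"
proof -
  have "real (num_faces k (convex hull W)) \<le> real (card {S. S \<subseteq> W \<and> card S = k + 1})"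
    if "W \<subseteq> cube01 d" for W
  proof -
    have fin: "finite W" using that finite_cube01 finite_subset by blast
    have "num_faces k (convex hull W) \<le> card {S. S \<subseteq> W \<and> card S = k + 1 \<and>
        (\<exists>F. F face_of convex hull W \<and> S \<subseteq> F \<and> F \<subseteq> affine hull S)}"
      by (rule num_faces_convex_hull_le[OF fin])
    also have "\<dots> \<le> card {S. S \<subseteq> W \<and> card S = k + 1}"
      using fin by (intro card_mono) auto
    finally show ?thesis by simp
  qed
  then have "(\<Sum>W\<in>{W. W \<subseteq> cube01 d \<and> card W = m}. real (num_faces k (convex hull W)))
      \<le> real (2 ^ d choose m) * real (m choose (k + 1))"
    unfolding sum_binomial_subsets_cube01[symmetric] by (intro sum_mono) auto
  moreover have "real (2 ^ d choose m) * real (m choose (k + 1)) > 0" using assms by simp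
  ultimately show ?thesis unfolding expected_face_density_eq[OF assms(2)] by (simp add: divide_le_eq)
qed

lemma expected_face_density_le:
  assumes m: "k + 1 \<le> m" "m \<le> 2 ^ d" and p: "p \<ge> 0"
    and R: "\<And>S. S \<subseteq> cube01 d \<Longrightarrow> card S = k + 1 \<Longrightarrow> S \<notin> B \<Longrightarrow>
      real (card {W. S \<subseteq> W \<and> W \<subseteq> cube01 d \<and> card W = m \<and>
        (\<exists>F. F face_of convex hull W \<and> S \<subseteq> F \<and> F \<subseteq> affine hull S)})
      \<le> p * real ((2 ^ d - (k + 1)) choose (m - (k + 1)))"
  shows "expected_face_density k d m
    \<le> real (card {S \<in> B. S \<subseteq> cube01 d \<and> card S = k + 1}) / real (2 ^ d choose (k + 1)) + p"
proof -
  let ?Ws = "{W. W \<subseteq> cube01 d \<and> card W = m}"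
  have "(\<Sum>W\<in>?Ws. real (num_faces k (convex hull W))) \<le>
      (\<Sum>W\<in>?Ws. real (card {S. S \<subseteq> W \<and> card S = k + 1 \<and>
        (\<exists>F. F face_of convex hull W \<and> S \<subseteq> F \<and> F \<subseteq> affine hull S)}))"
    using finite_subset[OF _ finite_cube01]
    by (intro sum_mono of_nat_mono num_faces_convex_hull_le) blast
  also have "\<dots> \<le> (real (card {S \<in> B. S \<subseteq> cube01 d \<and> card S = k + 1}) / real (card (cube01 d) choose (k + 1)) + p)
        * (real (card (cube01 d) choose m) * real (m choose (k + 1)))"
    using m p R by (intro sum_card_pairs_le finite_cube01) (auto simp: card_cube01)
  finally have le: "(\<Sum>W\<in>?Ws. real (num_faces k (convex hull W))) \<le>
      (real (card {S \<in> B. S \<subseteq> cube01 d \<and> card S = k + 1}) / real (2 ^ d choose (k + 1)) + p)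
        * (real (2 ^ d choose m) * real (m choose (k + 1)))"
    by (simp only: card_cube01)
  have "real (2 ^ d choose m) * real (m choose (k + 1)) > 0" using m by simp
  with le show ?thesis unfolding expected_face_density_eq[OF m(2)] by (simp only: divide_le_eq if_True)
qed

text \<open>A (k + 1)-subset of W either fails the condition or contributes a k-face of its own, so
  the density falls short of 1 by at most the proportion of failures.\<close>

lemma expected_face_density_ge:
  assumes m: "k + 1 \<le> m" "m \<le> 2 ^ d" and p: "p \<ge> 0"
    and R: "\<And>S. S \<subseteq> cube01 d \<Longrightarrow> card S = k + 1 \<Longrightarrow> S \<notin> B \<Longrightarrow>
      real (card {W. S \<subseteq> W \<and> W \<subseteq> cube01 d \<and> card W = m \<and>
        \<not> (\<not> affine_dependent S \<and> convex hull S face_of convex hull W)})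
      \<le> p * real ((2 ^ d - (k + 1)) choose (m - (k + 1)))"
  shows "1 - expected_face_density k d m
    \<le> real (card {S \<in> B. S \<subseteq> cube01 d \<and> card S = k + 1}) / real (2 ^ d choose (k + 1)) + p"
proof -
  let ?Ws = "{W. W \<subseteq> cube01 d \<and> card W = m}" and ?r = "k + 1"
  let ?G = "\<lambda>S W. \<not> affine_dependent S \<and> convex hull S face_of convex hull W"
  let ?T = "real (2 ^ d choose m) * real (m choose ?r)"
  let ?q = "real (card {S \<in> B. S \<subseteq> cube01 d \<and> card S = k + 1}) / real (2 ^ d choose (k + 1)) + p"
  have "?T = (\<Sum>W\<in>?Ws. real (card {S. S \<subseteq> W \<and> card S = ?r}))"
    by (rule sum_binomial_subsets_cube01[symmetric])
  also have "\<dots> \<le> (\<Sum>W\<in>?Ws. real (card {S. S \<subseteq> W \<and> card S = ?r \<and> \<not> ?G S W})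
      + real (num_faces k (convex hull W)))"
  proof (rule sum_mono)
    fix W assume "W \<in> ?Ws"
    then have W: "W \<subseteq> cube01 d" "finite W" using finite_cube01 finite_subset by auto
    have "card {S. S \<subseteq> W \<and> card S = ?r} =
        card ({S. S \<subseteq> W \<and> card S = ?r \<and> \<not> ?G S W} \<union> {S. S \<subseteq> W \<and> card S = ?r \<and> ?G S W})"
      by (rule arg_cong[where f = card]) blast
    also have "\<dots> \<le> card {S. S \<subseteq> W \<and> card S = ?r \<and> \<not> ?G S W} + card {S. S \<subseteq> W \<and> card S = ?r \<and> ?G S W}"
      by (rule card_Un_le)
    also have "\<dots> \<le> card {S. S \<subseteq> W \<and> card S = ?r \<and> \<not> ?G S W} + num_faces k (convex hull W)"
      by (intro add_left_mono num_faces_convex_hull_cube01_ge[OF W(1)])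
    finally show "real (card {S. S \<subseteq> W \<and> card S = ?r}) \<le>
        real (card {S. S \<subseteq> W \<and> card S = ?r \<and> \<not> ?G S W}) + real (num_faces k (convex hull W))"
      by linarith
  qed
  also have "\<dots> = (\<Sum>W\<in>?Ws. real (card {S. S \<subseteq> W \<and> card S = ?r \<and> \<not> ?G S W}))
      + (\<Sum>W\<in>?Ws. real (num_faces k (convex hull W)))"
    by (rule sum.distrib)
  also have "(\<Sum>W\<in>?Ws. real (card {S. S \<subseteq> W \<and> card S = ?r \<and> \<not> ?G S W}))
      \<le> (real (card {S \<in> B. S \<subseteq> cube01 d \<and> card S = ?r}) / real (card (cube01 d) choose ?r) + p)
        * (real (card (cube01 d) choose m) * real (m choose ?r))"
    using m p R by (intro sum_card_pairs_le finite_cube01) (auto simp: card_cube01)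
  finally have le: "?T \<le> ?q * ?T + (\<Sum>W\<in>?Ws. real (num_faces k (convex hull W)))"
    by (simp only: card_cube01)
  have pos: "?T > 0" using m by simp
  have E: "expected_face_density k d m * ?T = (\<Sum>W\<in>?Ws. real (num_faces k (convex hull W)))"
    by (rule nonzero_eq_divide_eq[THEN iffD1, OF less_imp_neq[OF pos, symmetric] expected_face_density_eq[OF m(2)]])
  have gen: "1 - e \<le> q" if "t \<le> q * t + e * t" "t > 0" for q e t :: real
  proof (rule mult_left_le_imp_le)
    show "t * (1 - e) \<le> t * q" using that(1) by (simp add: algebra_simps)
  qed fact
  show ?thesis by (rule gen[OF le[folded E] pos])
qed

subsection \<open>Points given by the columns of a 0/1-matrix\<close>

text \<open>The points are the rows of a 0/1-matrix given by its columns. Uniform columns in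
  \<open>Pow {..<r}\<close> make the coordinates independent, which a uniform r-subset of the cube
  does not provide directly.\<close>

definition col_point :: "nat \<Rightarrow> (nat \<Rightarrow> nat set) \<Rightarrow> nat \<Rightarrow> nat \<Rightarrow> real" where
  "col_point d c s = (\<lambda>j. if j < d \<and> s \<in> c j then 1 else 0)"

definition col_count :: "nat \<Rightarrow> (nat \<Rightarrow> nat set) \<Rightarrow> nat set \<Rightarrow> nat" where
  "col_count d c T = card {j. j < d \<and> c j = T}"

definition typical :: "nat \<Rightarrow> nat \<Rightarrow> real \<Rightarrow> (nat \<Rightarrow> nat set) \<Rightarrow> bool" where
  "typical d r \<delta> c \<longleftrightarrow> (\<forall>j<d. c j \<subseteq> {..<r}) \<and>
    (\<forall>T\<subseteq>{..<r}. \<bar>real (col_count d c T) - real d / 2 ^ r\<bar> \<le> \<delta> * (real d / 2 ^ r))"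

lemma col_point_in_cube01: "col_point d c s \<in> cube01 d"
  by (auto simp: cube01_iff col_point_def)

lemma sum_columns:
  fixes F :: "nat set \<Rightarrow> real"
  assumes "\<And>j. j < d \<Longrightarrow> c j \<subseteq> {..<r}"
  shows "(\<Sum>j<d. F (c j)) = (\<Sum>T\<in>Pow {..<r}. real (col_count d c T) * F T)"
proof -
  have "(\<Sum>j<d. F (c j)) = (\<Sum>T\<in>Pow {..<r}. \<Sum>j\<in>{j\<in>{..<d}. c j = T}. F (c j))"
    using assms by (intro sum.group[symmetric]) auto
  also have "\<dots> = (\<Sum>T\<in>Pow {..<r}. real (col_count d c T) * F T)"
    by (intro sum.cong) (simp_all add: col_count_def lessThan_def)
  finally show ?thesis .
qed

text \<open>Chebyshev's inequality for each of the \<open>2 ^ r\<close> sets T, applied to the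
  centred indicator \<open>g T\<close>, followed by a union bound.\<close>

lemma card_not_typical_le:
  assumes "0 < \<delta>" "0 < d"
  shows "real (card {c \<in> PiE {..<d} (\<lambda>_. Pow {..<r}). \<not> typical d r \<delta> c})
    \<le> 2 ^ r * (real d * (2 ^ r) ^ d / (\<delta> * (real d / 2 ^ r))\<^sup>2)"
proof -
  let ?Q = "Pow {..<r}"
  define g where "g T j t = (if t = T then 1 else 0) - (1 / 2 ^ r :: real)" for T :: "nat set" and j :: nat and t
  let ?\<eta> = "\<delta> * (real d / 2 ^ r)"
  let ?D = "\<lambda>T. {c \<in> PiE {..<d} (\<lambda>_. ?Q). \<bar>\<Sum>j<d. g T j (c j)\<bar> > ?\<eta>}"
  have count: "(\<Sum>j<d. g T j (c j)) = real (col_count d c T) - real d / 2 ^ r" for T c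
  proof -
    have "(\<Sum>j<d. if c j = T then 1 else 0::real) = real (card {j\<in>{..<d}. c j = T})"
      by (simp flip: sum.inter_filter)
    then show ?thesis by (simp add: g_def sum_subtractf col_count_def)
  qed
  have fin: "finite (PiE {..<d} (\<lambda>_. ?Q))" by (intro finite_PiE) auto
  have "{c \<in> PiE {..<d} (\<lambda>_. ?Q). \<not> typical d r \<delta> c} \<subseteq> (\<Union>T\<in>?Q. ?D T)"
    unfolding typical_def count by (force simp: PiE_iff not_le)
  then have "card {c \<in> PiE {..<d} (\<lambda>_. ?Q). \<not> typical d r \<delta> c} \<le> card (\<Union>T\<in>?Q. ?D T)"
    using fin by (intro card_mono) auto
  also have "\<dots> \<le> (\<Sum>T\<in>?Q. card (?D T))" by (rule card_UN_le) simp
  finally have "real (card {c \<in> PiE {..<d} (\<lambda>_. ?Q). \<not> typical d r \<delta> c}) \<le> (\<Sum>T\<in>?Q. real (card (?D T)))"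
    by (simp flip: of_nat_sum)
  also have "\<dots> \<le> (\<Sum>T\<in>?Q. real d * (2 ^ r) ^ d / ?\<eta>\<^sup>2)"
  proof (rule sum_mono)
    fix T assume T: "T \<in> ?Q"
    have "(\<Sum>t\<in>?Q. g T j t) = 0" for j
      using T by (simp add: g_def sum_subtractf card_Pow)
    moreover have "\<bar>g T j t\<bar> \<le> 1" for j t by (simp add: g_def)
    ultimately show "real (card (?D T)) \<le> real d * (2 ^ r) ^ d / ?\<eta>\<^sup>2"
      using card_PiE_deviation_le[of "{..<d}" ?Q "g T" 1 ?\<eta>] assms by (simp add: card_Pow)
  qed
  finally show ?thesis by (simp add: card_Pow)
qed

text \<open>Every S arises from a column function through an enumeration of its points, so
  exceptional S are no more numerous than atypical column functions. Counting one enumeration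
  instead of r! loses only a constant factor.\<close>

lemma card_not_typical_subsets_le:
  assumes "0 < \<delta>" "0 < d"
  shows "real (card {S. S \<subseteq> cube01 d \<and> card S = r \<and>
      \<not> (\<exists>c. typical d r \<delta> c \<and> S = col_point d c ` {..<r})})
    \<le> 2 ^ r * (real d * (2 ^ r) ^ d / (\<delta> * (real d / 2 ^ r))\<^sup>2)"
proof -
  let ?B = "{S. S \<subseteq> cube01 d \<and> card S = r \<and> \<not> (\<exists>c. typical d r \<delta> c \<and> S = col_point d c ` {..<r})}"
  let ?N = "{c \<in> PiE {..<d} (\<lambda>_. Pow {..<r}). \<not> typical d r \<delta> c}"
  have fin: "finite ?N" by (rule finite_subset[of _ "PiE {..<d} (\<lambda>_. Pow {..<r})"]) (auto intro!: finite_PiE)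
  have "?B \<subseteq> (\<lambda>c. col_point d c ` {..<r}) ` ?N"
  proof
    fix S assume S: "S \<in> ?B"
    then have "finite S" using finite_cube01 finite_subset by blast
    then obtain v where "bij_betw v {0..<card S} S" using ex_bij_betw_nat_finite by blast
    then have v: "v ` {..<r} = S" using S by (simp add: bij_betw_def atLeast0LessThan)
    define c where "c = restrict (\<lambda>j. {s. s < r \<and> v s j = 1}) {..<d}"
    have "col_point d c s = v s" if s: "s < r" for s
    proof
      fix j
      have "v s \<in> cube01 d" using v S s by blast
      then have "v s j = 0 \<or> v s j = 1" "j \<ge> d \<Longrightarrow> v s j = 0" by (auto simp: cube01_iff)
      then show "col_point d c s j = v s j" using s by (auto simp: col_point_def c_def)
    qed
    then have "col_point d c ` {..<r} = v ` {..<r}" by (intro image_cong) auto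
    then have Seq: "S = col_point d c ` {..<r}" using v by simp
    moreover from this have "\<not> typical d r \<delta> c" using S by blast
    moreover have "c \<in> PiE {..<d} (\<lambda>_. Pow {..<r})" by (auto simp: c_def)
    ultimately show "S \<in> (\<lambda>c. col_point d c ` {..<r}) ` ?N" by blast
  qed
  then have "card ?B \<le> card ((\<lambda>c. col_point d c ` {..<r}) ` ?N)" using fin by (intro card_mono) auto
  also have "\<dots> \<le> card ?N" using fin by (rule card_image_le)
  finally show ?thesis using card_not_typical_le[OF assms, of r] by linarith
qed

lemma typical_column_exists:
  assumes "typical d r \<delta> c" "\<delta> < 1" "0 < d" "T \<subseteq> {..<r}"
  shows "\<exists>j<d. c j = T"
proof -
  have "\<bar>real (col_count d c T) - real d / 2 ^ r\<bar> \<le> \<delta> * (real d / 2 ^ r)"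
    using assms by (simp add: typical_def)
  moreover have "\<delta> * (real d / 2 ^ r) < 1 * (real d / 2 ^ r)" using assms by (intro mult_strict_right_mono) auto
  ultimately have "col_count d c T \<noteq> 0" by (intro notI) simp
  then show ?thesis by (auto simp: col_count_def)
qed

text \<open>
  The coordinate \<open>j\<close> plays the role of a dual basis vector of \<open>v\<close> in the next two lemmas.
\<close>

lemma affine_independent_dual_coordinates:
  fixes S :: "('i \<Rightarrow> real) set"
  assumes "\<And>v. v \<in> S \<Longrightarrow> \<exists>j. v j = 1 \<and> (\<forall>w\<in>S. w \<noteq> v \<longrightarrow> w j = 0)"
  shows "\<not> affine_dependent S"
proof
  assume "affine_dependent S"
  then obtain T u v where T: "finite T" "T \<subseteq> S" "v \<in> T" "u v \<noteq> 0" "(\<Sum>w\<in>T. u w *\<^sub>R w) = 0"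
    unfolding affine_dependent_explicit by blast
  obtain j where j: "v j = 1" "\<forall>w\<in>S. w \<noteq> v \<longrightarrow> w j = 0" using assms T by blast
  have "0 = (\<Sum>w\<in>T. u w *\<^sub>R w) j" using T by simp
  also have "\<dots> = (\<Sum>w\<in>T. u w * w j)" by (simp add: sum_apply_fun)
  also have "\<dots> = (\<Sum>w\<in>T. if w = v then u v else 0)" using j T by (intro sum.cong) auto
  also have "\<dots> = u v" using T by simp
  finally show False using T by simp
qed

lemma affine_hull_dual_coordinates_cube01:
  assumes "finite S"
    and "\<And>v. v \<in> S \<Longrightarrow> \<exists>j. v j = 1 \<and> (\<forall>w\<in>S. w \<noteq> v \<longrightarrow> w j = 0)"
    and x: "x \<in> affine hull S" "x \<in> cube01 d"
  shows "x \<in> S"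
proof -
  obtain u where u: "sum u S = 1" "(\<Sum>v\<in>S. u v *\<^sub>R v) = x"
    using x(1) affine_hull_finite[OF assms(1)] by auto
  have coef: "u v = 0 \<or> u v = 1" if v: "v \<in> S" for v
  proof -
    obtain j where j: "v j = 1" "\<forall>w\<in>S. w \<noteq> v \<longrightarrow> w j = 0" using assms(2) v by blast
    have "x j = (\<Sum>w\<in>S. u w * w j)" by (simp add: sum_apply_fun flip: u(2))
    also have "\<dots> = (\<Sum>w\<in>S. if w = v then u v else 0)" using j by (intro sum.cong) auto
    also have "\<dots> = u v" using v assms(1) by simp
    finally have "x j = u v" .
    moreover have "x j = 0 \<or> x j = 1" using x(2) by (auto simp: cube01_iff)
    ultimately show ?thesis by metis
  qed
  have "\<exists>v\<in>S. u v = 1"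
  proof (rule ccontr)
    assume "\<not> ?thesis"
    then have "sum u S = (\<Sum>v\<in>S. 0)" using coef by (intro sum.cong) auto
    then show False using u by simp
  qed
  then obtain v where v: "v \<in> S" "u v = 1" by blast
  have "sum u (S - {v}) = 0" using u(1) v assms(1) by (simp add: sum_diff1)
  moreover have "\<And>w. w \<in> S - {v} \<Longrightarrow> 0 \<le> u w" using coef by force
  ultimately have zero: "\<forall>w\<in>S - {v}. u w = 0"
    using sum_nonneg_eq_0_iff[of "S - {v}" u] assms(1) by simp
  have "(\<Sum>w\<in>S. u w *\<^sub>R w) = (\<Sum>w\<in>S. if w = v then v else 0)"
    using zero v by (intro sum.cong) auto
  then have "x = v" using u(2) v assms(1) by simp
  then show ?thesis using v by simp
qed

text \<open>A typical matrix has the column {s}, and in such a coordinate only point number s has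
  the entry 1.\<close>

lemma typical_dual_coordinates:
  assumes "typical d r \<delta> c" "\<delta> < 1" "0 < d" "v \<in> col_point d c ` {..<r}"
  shows "\<exists>j. v j = 1 \<and> (\<forall>w\<in>col_point d c ` {..<r}. w \<noteq> v \<longrightarrow> w j = 0)"
proof -
  obtain s where s: "s < r" "v = col_point d c s" using assms(4) by auto
  obtain j where "j < d" "c j = {s}" using typical_column_exists[OF assms(1-3), of "{s}"] s by auto
  then show ?thesis using s by (intro exI[of _ j]) (auto simp: col_point_def)
qed

subsection \<open>Half-spaces containing the barycenter\<close>

text \<open>Coordinate j is copied from point number \<open>e j\<close>. For uniform
  \<open>e\<close> the coordinates are independent with means \<open>card (c j) / r\<close>, so
  counting selections \<open>e\<close> realizes the product distribution with mean b.\<close>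

definition mixed_point :: "nat \<Rightarrow> (nat \<Rightarrow> nat set) \<Rightarrow> (nat \<Rightarrow> nat) \<Rightarrow> nat \<Rightarrow> real" where
  "mixed_point d c e = (\<lambda>j. if j < d \<and> e j \<in> c j then 1 else 0)"

lemma mixed_point_in_cube01: "mixed_point d c e \<in> cube01 d"
  by (auto simp: cube01_iff mixed_point_def)

lemma bij_betw_shift_mod:
  fixes a r :: nat
  assumes "0 < r"
  shows "bij_betw (\<lambda>s. (a + s) mod r) {..<r} {..<r}"
proof -
  have "inj_on (\<lambda>s. (a + s) mod r) {..<r}"
  proof (rule inj_onI)
    fix s t assume *: "s \<in> {..<r}" "t \<in> {..<r}" "(a + s) mod r = (a + t) mod r"
    let ?b = "r - a mod r"
    have "?b + a = r * (a div r) + r"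
      using mod_le_divisor[OF assms, of a] mult_div_mod_eq[of r a] by linarith
    then have "?b + a = r * (a div r + 1)" by simp
    then have cancel: "(?b + (a + u)) mod r = u mod r" for u
      by (metis add.assoc add.commute mod_mult_self2)
    have "(?b + (a + s)) mod r = (?b + (a + t)) mod r" by (rule mod_add_cong[OF refl *(3)])
    then have "s mod r = t mod r" by (simp only: cancel)
    then show "s = t" using * by simp
  qed
  moreover have "(\<lambda>s. (a + s) mod r) ` {..<r} \<subseteq> {..<r}" using assms by auto
  ultimately show ?thesis by (simp add: bij_betw_def endo_inj_surj)
qed

text \<open>
  The cyclic shifts of a selection \<open>e\<close> have \<open>r\<close> times the barycenter as sum of their mixed points, so
  one of them lies in any given half-space containing the barycenter.
\<close>

lemma card_mixed_points_halfspace_ge: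
  fixes f :: "(nat \<Rightarrow> real) \<Rightarrow> real"
  assumes r: "0 < r" and c: "\<And>j. j < d \<Longrightarrow> c j \<subseteq> {..<r}" and f: "linear f"
    and b: "b = (1 / real r) *\<^sub>R (\<Sum>s<r. col_point d c s)"
  shows "r ^ d \<le> r * card {e \<in> PiE {..<d} (\<lambda>_. {..<r}). f (mixed_point d c e) \<ge> f b}"
proof -
  interpret f: linear f by fact
  let ?P = "PiE {..<d} (\<lambda>_. {..<r})"
  let ?G = "{e \<in> ?P. f (mixed_point d c e) \<ge> f b}"
  define shift where "shift s e = restrict (\<lambda>j. (e j + s) mod r) {..<d}" for s and e :: "nat \<Rightarrow> nat"
  have fin: "finite ?P" by (intro finite_PiE) auto
  have shift_mem: "shift s e \<in> ?P" for s e using r by (auto simp: shift_def)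
  have sum_shift: "(\<Sum>s<r. mixed_point d c (shift s e)) = (\<Sum>s<r. col_point d c s)" for e
  proof
    fix j
    have "(\<Sum>s<r. mixed_point d c (shift s e) j) = (\<Sum>s<r. col_point d c ((e j + s) mod r) j)"
      by (intro sum.cong) (auto simp: mixed_point_def shift_def col_point_def)
    also have "\<dots> = (\<Sum>s<r. col_point d c s j)"
      by (rule sum.reindex_bij_betw[OF bij_betw_shift_mod[OF r]])
    finally show "(\<Sum>s<r. mixed_point d c (shift s e)) j = (\<Sum>s<r. col_point d c s) j"
      by (simp add: sum_apply_fun)
  qed
  have ex: "\<exists>s<r. shift s e \<in> ?G" for e
  proof (rule ccontr)
    assume "\<not> ?thesis"
    then have less: "f (mixed_point d c (shift s e)) < f b" if "s < r" for s
      using that shift_mem by (auto simp: not_le)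
    have "(\<Sum>s<r. f (mixed_point d c (shift s e))) < (\<Sum>s<r. f b)"
      using r less by (intro sum_strict_mono) auto
    also have "\<dots> = f (\<Sum>s<r. col_point d c s)" using r by (simp add: b f.scale)
    also have "\<dots> = (\<Sum>s<r. f (mixed_point d c (shift s e)))"
      by (simp add: f.sum flip: sum_shift[of e])
    finally show False by simp
  qed
  have inj: "inj_on (shift s) ?P" for s
  proof (rule inj_onI)
    fix e e' assume *: "e \<in> ?P" "e' \<in> ?P" "shift s e = shift s e'"
    show "e = e'"
    proof (rule PiE_ext[OF *(1,2)])
      fix j assume j: "j \<in> {..<d}"
      then have "(s + e j) mod r = (s + e' j) mod r"
        using fun_cong[OF *(3), of j] by (simp add: shift_def add.commute)
      then show "e j = e' j"
        using PiE_mem[OF *(1) j] PiE_mem[OF *(2) j]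
        by (rule inj_onD[OF bij_betw_imp_inj_on[OF bij_betw_shift_mod[OF r]]])
    qed
  qed
  \<comment> \<open>Every selection has a good shift, and the injective map \<open>shift s\<close>
    sends the selections that are good at s into \<open>?G\<close>.\<close>
  have "?P \<subseteq> (\<Union>s<r. {e \<in> ?P. shift s e \<in> ?G})" using ex by blast
  then have "card ?P \<le> card (\<Union>s<r. {e \<in> ?P. shift s e \<in> ?G})" using fin by (intro card_mono) auto
  also have "\<dots> \<le> (\<Sum>s<r. card {e \<in> ?P. shift s e \<in> ?G})" by (rule card_UN_le) simp
  also have "\<dots> \<le> (\<Sum>s<r. card ?G)"
  proof (rule sum_mono)
    fix s
    have "inj_on (shift s) {e \<in> ?P. shift s e \<in> ?G}" using inj by (rule inj_on_subset) auto
    then show "card {e \<in> ?P. shift s e \<in> ?G} \<le> card ?G"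
      by (rule card_inj_on_le) (use fin in auto)
  qed
  finally show ?thesis by (simp add: card_PiE)
qed

text \<open>Divided by r, this is the probability of the bit that t selects in coordinate j. The
  product over all j, divided by \<open>r ^ d\<close>, is the mass of a mixed point.\<close>

definition multiplicity :: "(nat \<Rightarrow> nat set) \<Rightarrow> nat \<Rightarrow> nat \<Rightarrow> nat \<Rightarrow> nat" where
  "multiplicity c r j t = card {s. s < r \<and> (s \<in> c j \<longleftrightarrow> t \<in> c j)}"

lemma card_mixed_point_fibre:
  assumes e: "e \<in> PiE {..<d} (\<lambda>_. {..<r})"
  shows "card {e' \<in> PiE {..<d} (\<lambda>_. {..<r}). mixed_point d c e' = mixed_point d c e}
    = (\<Prod>j<d. multiplicity c r j (e j))"
proof -
  have "mixed_point d c e' = mixed_point d c e \<longleftrightarrow> (\<forall>j<d. e' j \<in> c j \<longleftrightarrow> e j \<in> c j)" for e'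
    by (force simp: mixed_point_def fun_eq_iff split: if_splits)
  then have "{e' \<in> PiE {..<d} (\<lambda>_. {..<r}). mixed_point d c e' = mixed_point d c e}
      = PiE {..<d} (\<lambda>j. {s. s < r \<and> (s \<in> c j \<longleftrightarrow> e j \<in> c j)})"
    by (auto simp: PiE_iff extensional_def)
  then show ?thesis by (simp add: card_PiE multiplicity_def)
qed

lemma multiplicity_bounds:
  assumes "t < r"
  shows "0 < multiplicity c r j t" "multiplicity c r j t \<le> r"
proof -
  show "0 < multiplicity c r j t" using assms by (auto simp: multiplicity_def card_gt_0_iff)
  have "multiplicity c r j t \<le> card {..<r}" unfolding multiplicity_def by (intro card_mono) auto
  then show "multiplicity c r j t \<le> r" by simp
qed

text \<open>The entropy is the average of minus log (multiplicity / r): \<open>card (c j)\<close> of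
  the t have multiplicity \<open>card (c j)\<close>, the others r minus that.\<close>

lemma sum_log_multiplicity:
  assumes r: "0 < r" and c: "c j \<subseteq> {..<r}"
  shows "(\<Sum>t<r. log 2 (multiplicity c r j t)) = r * (log 2 r - binary_entropy (card (c j) / r))"
proof -
  let ?i = "card (c j)"
  have fin: "finite (c j)" using c finite_subset by blast
  have le: "?i \<le> r" using card_mono[OF _ c] by simp
  have in_c: "multiplicity c r j t = ?i" if "t \<in> c j" for t
  proof -
    have "{s. s < r \<and> (s \<in> c j \<longleftrightarrow> t \<in> c j)} = c j" using that c by auto
    then show ?thesis by (simp add: multiplicity_def)
  qed
  have notin_c: "multiplicity c r j t = r - ?i" if "t \<notin> c j" for t
  proof -
    have "{s. s < r \<and> (s \<in> c j \<longleftrightarrow> t \<in> c j)} = {..<r} - c j" using that by auto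
    then show ?thesis using fin c by (simp add: multiplicity_def card_Diff_subset)
  qed
  have "(\<Sum>t<r. log 2 (multiplicity c r j t))
      = (\<Sum>t\<in>{..<r} - c j. log 2 (multiplicity c r j t)) + (\<Sum>t\<in>c j. log 2 (multiplicity c r j t))"
    using c by (intro sum.subset_diff) auto
  also have "(\<Sum>t\<in>c j. log 2 (multiplicity c r j t)) = ?i * log 2 ?i" by (simp add: in_c)
  also have "(\<Sum>t\<in>{..<r} - c j. log 2 (multiplicity c r j t)) = (r - ?i) * log 2 (r - ?i)"
    using fin c le by (simp add: notin_c card_Diff_subset)
  finally have "(\<Sum>t<r. log 2 (multiplicity c r j t)) = (r - ?i) * log 2 (r - ?i) + ?i * log 2 ?i" .
  also have "\<dots> = r * (log 2 r - binary_entropy (?i / r))"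
  proof (cases "?i = 0 \<or> ?i = r")
    \<comment> \<open>The terms 1 / 0 and log 0 occur only with the factor 0, which gives the usual
      convention h(0) = h(1) = 0.\<close>
    case True
    then show ?thesis using r by (auto simp: binary_entropy_def)
  next
    case False
    then have i: "0 < ?i" "?i < r" using le by auto
    have 1: "log 2 (1 / (?i / r)) = log 2 r - log 2 ?i" using i by (simp add: log_divide)
    have 2: "1 - ?i / r = (real r - ?i) / r" using i by (simp add: field_simps)
    have 3: "log 2 (1 / ((real r - ?i) / r)) = log 2 r - log 2 (real r - ?i)"
      using i by (simp add: log_divide)
    show ?thesis unfolding binary_entropy_def 2 1 3
      using i by (simp add: of_nat_diff field_simps)
  qed
  finally show ?thesis .
qed

text \<open>Asymptotic equipartition. Off \<open>?D\<close> the mass of a mixed point exceeds its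
  typical value by at most the factor 2^(\<eta> d), so a cube point is hit by at most K such
  selections. At least r^d / r selections fall into the half-space, and the assumption on \<eta> and
  d is what lets Chebyshev bound \<open>?D\<close> by half of that. The remaining r^d / (2 r)
  selections are divided by K.\<close>

lemma card_halfspace_ge:
  fixes f :: "(nat \<Rightarrow> real) \<Rightarrow> real"
  assumes r: "0 < r" and c: "\<And>j. j < d \<Longrightarrow> c j \<subseteq> {..<r}" and f: "linear f"
    and b: "b = (1 / real r) *\<^sub>R (\<Sum>s<r. col_point d c s)"
    and \<eta>: "0 < \<eta>" "2 * r * (log 2 r)\<^sup>2 \<le> \<eta>\<^sup>2 * d" and d: "0 < d"
  shows "2 powr ((\<Sum>j<d. binary_entropy (card (c j) / r)) - \<eta> * d) / (2 * r)
    \<le> real (card {x \<in> cube01 d. f x \<ge> f b})"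
proof -
  let ?P = "PiE {..<d} (\<lambda>_. {..<r})" and ?H = "{x \<in> cube01 d. f x \<ge> f b}"
  let ?G = "{e \<in> ?P. f (mixed_point d c e) \<ge> f b}"
  let ?h = "\<lambda>j. binary_entropy (card (c j) / r)"
  define \<mu> where "\<mu> j = log 2 r - ?h j" for j
  define g where "g j t = log 2 (multiplicity c r j t) - \<mu> j" for j t
  let ?D = "{e \<in> ?P. \<bar>\<Sum>j<d. g j (e j)\<bar> > \<eta> * d}"
  have fin: "finite ?P" by (intro finite_PiE) auto
  have log_bounds: "0 \<le> log 2 (multiplicity c r j t)" "log 2 (multiplicity c r j t) \<le> log 2 r" if "t < r" for j t
    using multiplicity_bounds[OF that, of c j] by (auto simp: Suc_leI)
  have sum_log: "(\<Sum>t<r. log 2 (multiplicity c r j t)) = r * \<mu> j" if "j < d" for j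
    unfolding \<mu>_def by (rule sum_log_multiplicity[OF r]) (rule c[OF that])
  have \<mu>: "0 \<le> \<mu> j" "\<mu> j \<le> log 2 r" if "j < d" for j
  proof -
    have "0 \<le> (\<Sum>t<r. log 2 (multiplicity c r j t))" by (intro sum_nonneg) (use log_bounds in auto)
    then show "0 \<le> \<mu> j" using sum_log[OF that] r by (simp add: zero_le_mult_iff)
    have "(\<Sum>t<r. log 2 (multiplicity c r j t)) \<le> (\<Sum>t<r. log 2 r)"
      by (intro sum_mono) (use log_bounds in auto)
    then show "\<mu> j \<le> log 2 r" using sum_log[OF that] r by simp
  qed
  have card_D: "real (card ?D) \<le> real d * r ^ d * (log 2 r)\<^sup>2 / (\<eta> * d)\<^sup>2"
  proof -
    have "(\<Sum>t<r. g j t) = 0" if "j < d" for j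
      using sum_log[OF that] by (simp add: g_def sum_subtractf)
    moreover have "\<bar>g j t\<bar> \<le> log 2 r" if "j < d" "t < r" for j t
      using \<mu>[OF that(1)] log_bounds[OF that(2), of j] by (auto simp: g_def abs_le_iff)
    ultimately show ?thesis
      using card_PiE_deviation_le[of "{..<d}" "{..<r}" g "log 2 r" "\<eta> * d"] \<eta> d by simp
  qed
  define K where "K = 2 powr (d * log 2 r - (\<Sum>j<d. ?h j) + \<eta> * d)"
  have fibre: "real (card {e \<in> ?G - ?D. mixed_point d c e = x}) \<le> K" for x
  proof (cases "\<exists>e0 \<in> ?G - ?D. mixed_point d c e0 = x")
    case True
    then obtain e0 where e0: "e0 \<in> ?P" "e0 \<notin> ?D" "mixed_point d c e0 = x" by blast
    have e0r: "e0 j < r" if "j < d" for j using e0(1) that by (auto simp: PiE_iff)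
    have "card {e \<in> ?G - ?D. mixed_point d c e = x} \<le> card {e \<in> ?P. mixed_point d c e = mixed_point d c e0}"
      using fin e0(3) by (intro card_mono) auto
    also have "\<dots> = (\<Prod>j<d. multiplicity c r j (e0 j))" by (rule card_mixed_point_fibre[OF e0(1)])
    finally have "real (card {e \<in> ?G - ?D. mixed_point d c e = x}) \<le> (\<Prod>j<d. real (multiplicity c r j (e0 j)))"
      by (simp flip: of_nat_prod)
    also have "\<dots> = (\<Prod>j<d. 2 powr log 2 (multiplicity c r j (e0 j)))"
      using multiplicity_bounds(1)[OF e0r] by (intro prod.cong) auto
    also have "\<dots> = 2 powr (\<Sum>j<d. log 2 (multiplicity c r j (e0 j)))" by (simp add: powr_sum)
    also have "(\<Sum>j<d. log 2 (multiplicity c r j (e0 j))) = (\<Sum>j<d. g j (e0 j)) + (\<Sum>j<d. \<mu> j)"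
      by (simp add: g_def sum_subtractf)
    also have "(\<Sum>j<d. \<mu> j) = d * log 2 r - (\<Sum>j<d. ?h j)" by (simp add: \<mu>_def sum_subtractf)
    finally have "real (card {e \<in> ?G - ?D. mixed_point d c e = x})
        \<le> 2 powr ((\<Sum>j<d. g j (e0 j)) + (d * log 2 r - (\<Sum>j<d. ?h j)))" .
    also have "(\<Sum>j<d. g j (e0 j)) \<le> \<eta> * d" using e0 by auto
    then have "2 powr ((\<Sum>j<d. g j (e0 j)) + (d * log 2 r - (\<Sum>j<d. ?h j))) \<le> K"
      unfolding K_def by (intro powr_mono) auto
    finally show ?thesis .
  next
    case False
    then have "{e \<in> ?G - ?D. mixed_point d c e = x} = {}" by blast
    then show ?thesis by (simp only: card.empty) (simp add: K_def)
  qed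
  have "?G - ?D \<subseteq> (\<Union>x\<in>?H. {e \<in> ?G - ?D. mixed_point d c e = x})"
    using mixed_point_in_cube01 by auto
  then have "card (?G - ?D) \<le> card (\<Union>x\<in>?H. {e \<in> ?G - ?D. mixed_point d c e = x})"
    using fin finite_cube01 by (intro card_mono) auto
  also have "\<dots> \<le> (\<Sum>x\<in>?H. card {e \<in> ?G - ?D. mixed_point d c e = x})"
    using finite_cube01 by (intro card_UN_le) auto
  finally have "real (card (?G - ?D)) \<le> (\<Sum>x\<in>?H. real (card {e \<in> ?G - ?D. mixed_point d c e = x}))"
    by (simp flip: of_nat_sum)
  also have "\<dots> \<le> (\<Sum>x\<in>?H. K)" by (intro sum_mono fibre)
  finally have GD: "real (card (?G - ?D)) \<le> card ?H * K" by simp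
  have "card ?G \<le> card (?G - ?D) + card ?D"
    using fin by (intro order_trans[OF card_mono card_Un_le]) auto
  then have 1: "real (card ?G) \<le> real (card (?G - ?D)) + real (card ?D)" by linarith
  have 2: "real (r ^ d) \<le> real r * real (card ?G)"
    unfolding of_nat_mult[symmetric]
    by (intro of_nat_mono card_mixed_points_halfspace_ge[OF r _ f b]) (rule c)
  have 3: "real (card ?D) \<le> real (r ^ d) / (2 * real r)"
  proof -
    have "real d * r ^ d * (log 2 r)\<^sup>2 / (\<eta> * d)\<^sup>2 = r ^ d / (2 * r) * ((2 * r * (log 2 r)\<^sup>2) / (\<eta>\<^sup>2 * d))"
      using r d \<eta> by (simp add: field_simps power2_eq_square)
    also have "\<dots> \<le> r ^ d / (2 * r) * 1"
      using r d \<eta> by (intro mult_left_mono) (auto simp: divide_le_eq)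
    finally show ?thesis using card_D by simp
  qed
  have arith: "R / (2 * q) \<le> x" if "g \<le> x + y" "R \<le> q * g" "y \<le> R / (2 * q)" "q > 0" for g x y q R :: real
  proof -
    have "R / q \<le> g" using that by (simp add: divide_le_eq mult.commute)
    moreover have "R / (2 * q) = R / q / 2" by simp
    ultimately show ?thesis using that by linarith
  qed
  have "r ^ d / (2 * r) \<le> real (card (?G - ?D))"
    using arith[OF 1 2 3] r by simp
  then have "r ^ d / (2 * r) \<le> card ?H * K" using GD by linarith
  moreover have "real (r ^ d) = K * 2 powr ((\<Sum>j<d. ?h j) - \<eta> * d)"
  proof -
    have "2 powr (log 2 r * real d) = real (r ^ d)"
      using r by (simp add: powr_realpow flip: powr_powr)
    then show ?thesis by (simp add: K_def mult.commute flip: powr_add)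
  qed
  ultimately have "K * (2 powr ((\<Sum>j<d. ?h j) - \<eta> * d) / (2 * r)) \<le> K * card ?H"
    by (simp add: mult_ac)
  moreover have "K > 0" by (simp add: K_def)
  ultimately show ?thesis by (subst (asm) mult_le_cancel_left_pos) auto
qed

subsection \<open>Entropy\<close>

lemma binary_entropy_0 [simp]: "binary_entropy 0 = 0"
  and binary_entropy_1 [simp]: "binary_entropy 1 = 0"
  by (simp_all add: binary_entropy_def)

lemma binary_entropy_nonneg:
  assumes "0 \<le> p" "p \<le> 1"
  shows "0 \<le> binary_entropy p"
proof (cases "p = 0 \<or> p = 1")
  case False
  then show ?thesis using assms unfolding binary_entropy_def
    by (intro add_nonneg_nonneg mult_nonneg_nonneg) (auto simp: zero_le_log_cancel_iff)
qed auto

text \<open>Gibbs' inequality against the fair coin: ln x \<le> x - 1 is used at x = 1 / (2 q) for q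
  = p and q = 1 - p, and the linear error terms cancel. It yields \<tau> k \<ge> 0.\<close>

lemma binary_entropy_le_1:
  assumes "0 \<le> p" "p \<le> 1"
  shows "binary_entropy p \<le> 1"
proof (cases "p = 0 \<or> p = 1")
  case False
  then have p: "0 < p" "p < 1" using assms by auto
  have *: "q * log 2 (1 / q) \<le> q + (1 / 2 - q) / ln 2" if "0 < q" for q :: real
  proof -
    have "ln (1 / (2 * q)) \<le> 1 / (2 * q) - 1" using that by (intro ln_le_minus_one) auto
    then have "q * ln (1 / (2 * q)) \<le> q * (1 / (2 * q) - 1)" using that by (intro mult_left_mono) auto
    also have "\<dots> = 1 / 2 - q" using that by (simp add: field_simps)
    finally have le: "q * ln (1 / (2 * q)) / ln 2 \<le> (1 / 2 - q) / ln 2" by (intro divide_right_mono) auto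
    have "ln (1 / q) = ln (1 / (2 * q)) + ln 2" using that by (simp add: ln_div ln_mult)
    then have "q * log 2 (1 / q) = q + q * ln (1 / (2 * q)) / ln 2"
      by (simp add: log_def field_simps)
    then show ?thesis using le by simp
  qed
  have "binary_entropy p \<le> (p + (1 / 2 - p) / ln 2) + ((1 - p) + (1 / 2 - (1 - p)) / ln 2)"
    unfolding binary_entropy_def using *[of p] *[of "1 - p"] p by (intro add_mono) auto
  also have "\<dots> = 1 + ((1 / 2 - p) + (1 / 2 - (1 - p))) / ln 2" by (simp only: add_divide_distrib)
  finally show ?thesis by simp
qed auto

text \<open>The meaning of the threshold: with r = k + 1, the right side is the mean of h(card T /
  r) over a uniform set T of indices, hence the entropy per coordinate when all columns are equally
  frequent. As 1 - 2^(-k) = (2^r - 2) / 2^r, this factor cancels the normalization of H_r; the empty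
  and the full T contribute 0.\<close>

lemma one_minus_\<tau>:
  assumes "k \<ge> 1"
  shows "1 - \<tau> k = (\<Sum>T\<in>Pow {..<k + 1}. binary_entropy (card T / real (k + 1))) / 2 ^ (k + 1)"
proof -
  let ?r = "k + 1"
  let ?t = "\<lambda>i. real (?r choose i) * binary_entropy (real i / real ?r)"
  have "(\<Sum>T\<in>Pow {..<?r}. binary_entropy (card T / real ?r)) = (\<Sum>i\<le>?r. ?t i)"
    using sum_Pow_card[of "{..<?r}" "\<lambda>i. binary_entropy (real i / real ?r)"] by simp
  also have "\<dots> = (\<Sum>i = 1..?r - 1. ?t i)"
  proof (rule sum.mono_neutral_right)
    show "\<forall>i\<in>{..?r} - {1..?r - 1}. ?t i = 0"
    proof
      fix i assume "i \<in> {..?r} - {1..?r - 1}"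
      then have "i = 0 \<or> i = ?r" by auto
      then show "?t i = 0" by (elim disjE) (simp_all del: of_nat_add of_nat_Suc)
    qed
  qed auto
  finally have sum: "(\<Sum>T\<in>Pow {..<?r}. binary_entropy (card T / real ?r)) = (\<Sum>i = 1..?r - 1. ?t i)" .
  have pow: "(2::real) ^ k > 1" using assms by (intro one_less_power) auto
  have "1 - \<tau> k = (1 - 1 / 2 ^ k) * (1 / (2 ^ ?r - 2)) * (\<Sum>i = 1..?r - 1. ?t i)"
    by (simp add: \<tau>_def H_avg_def powr_minus powr_realpow inverse_eq_divide)
  also have "(1 - 1 / 2 ^ k) * (1 / (2 ^ ?r - 2)) = (1::real) / 2 ^ ?r"
    using pow by (simp add: field_simps)
  finally show ?thesis unfolding sum by (simp only: mult_1 times_divide_eq_left)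
qed

lemma \<tau>_bounds:
  assumes "k \<ge> 1"
  shows "0 \<le> \<tau> k" "\<tau> k \<le> 1"
proof -
  let ?S = "\<Sum>T\<in>Pow {..<k + 1}. binary_entropy (card T / real (k + 1))"
  have bounds: "0 \<le> card T / real (k + 1)" "card T / real (k + 1) \<le> 1" if "T \<in> Pow {..<k + 1}" for T
    using card_mono[of "{..<k + 1}" T] that by auto
  have "?S \<le> (\<Sum>T\<in>Pow {..<k + 1}. 1)" using bounds by (intro sum_mono binary_entropy_le_1) auto
  also have "\<dots> = 2 ^ (k + 1)" by (simp add: card_Pow)
  finally have "?S / 2 ^ (k + 1) \<le> 1" by (subst divide_le_eq_1) auto
  then show "0 \<le> \<tau> k" using one_minus_\<tau>[OF assms] by linarith
  have "0 \<le> ?S" using bounds by (intro sum_nonneg binary_entropy_nonneg) auto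
  then have "0 \<le> ?S / 2 ^ (k + 1)" by (rule divide_nonneg_nonneg) simp
  then show "\<tau> k \<le> 1" using one_minus_\<tau>[OF assms] by linarith
qed

lemma typical_entropy_ge:
  assumes "k \<ge> 1" "typical d (k + 1) \<delta> c" "\<delta> \<ge> 0"
  shows "(1 - \<tau> k - \<delta>) * d \<le> (\<Sum>j<d. binary_entropy (card (c j) / real (k + 1)))"
proof -
  let ?h = "\<lambda>T :: nat set. binary_entropy (card T / real (k + 1))"
  let ?D = "real d / 2 ^ (k + 1)"
  have h: "0 \<le> ?h T" if "T \<in> Pow {..<k + 1}" for T
    using card_mono[of "{..<k + 1}" T] that by (intro binary_entropy_nonneg) auto
  \<comment> \<open>The two factors of d differ by \<open>\<delta> * \<tau> k\<close>, which is
    nonnegative.\<close>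
  have "(1 - \<tau> k - \<delta>) * d \<le> (1 - \<delta>) * (1 - \<tau> k) * d"
    using assms \<tau>_bounds[OF assms(1)] by (intro mult_right_mono) (auto simp: algebra_simps)
  also have "\<dots> = (\<Sum>T\<in>Pow {..<k + 1}. (1 - \<delta>) * ?D * ?h T)"
    unfolding one_minus_\<tau>[OF assms(1)] sum_distrib_left[symmetric] by simp
  also have "\<dots> \<le> (\<Sum>T\<in>Pow {..<k + 1}. real (col_count d c T) * ?h T)"
  proof (intro sum_mono mult_right_mono h)
    fix T assume "T \<in> Pow {..<k + 1}"
    then have "\<bar>real (col_count d c T) - ?D\<bar> \<le> \<delta> * ?D" using assms(2) by (simp add: typical_def)
    then show "(1 - \<delta>) * ?D \<le> real (col_count d c T)" unfolding left_diff_distrib by linarith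
  qed
  also have "\<dots> = (\<Sum>j<d. ?h (c j))"
    using assms(2) by (intro sum_columns[symmetric]) (auto simp: typical_def)
  finally show ?thesis .
qed

subsection \<open>A functional supporting a typical simplex\<close>

text \<open>By symmetry the left side is the same for all s, and summing over s counts each T
  \<open>card T\<close> times. This is why the functional below takes equal values at all r
  vertices.\<close>

lemma sum_Pow_containing_card:
  fixes a :: "nat \<Rightarrow> real" and s r :: nat
  assumes "s < r"
  shows "(\<Sum>T | T \<subseteq> {..<r} \<and> s \<in> T. a (card T)) = (\<Sum>T\<in>Pow {..<r}. real (card T) * a (card T)) / r"
proof -
  let ?A = "\<lambda>s. \<Sum>T | T \<subseteq> {..<r} \<and> s \<in> T. a (card T)"
  have const: "?A s = (\<Sum>i\<le>r - 1. real (r - 1 choose i) * a (Suc i))" if s: "s < r" for s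
  proof -
    have "?A s = (\<Sum>T\<in>Pow ({..<r} - {s}). a (Suc (card T)))"
    proof (rule sum.reindex_bij_witness[where i = "insert s" and j = "\<lambda>T. T - {s}"])
      fix T assume "T \<in> {T. T \<subseteq> {..<r} \<and> s \<in> T}"
      then have T: "s \<in> T" "finite T" using finite_subset by blast+
      then have "Suc (card (T - {s})) = card T" by (intro card.remove[symmetric])
      then show "a (Suc (card (T - {s}))) = a (card T)" by simp
    qed (use s in auto)
    also have "\<dots> = (\<Sum>i\<le>r - 1. real (r - 1 choose i) * a (Suc i))"
      using sum_Pow_card[of "{..<r} - {s}" "\<lambda>i. a (Suc i)"] s by simp
    finally show ?thesis .
  qed
  have "r * ?A s = (\<Sum>t<r. ?A t)" using assms by (simp add: const)
  also have "\<dots> = (\<Sum>t<r. \<Sum>T | T \<in> Pow {..<r} \<and> t \<in> T. a (card T))" by simp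
  also have "\<dots> = (\<Sum>T\<in>Pow {..<r}. \<Sum>t | t \<in> {..<r} \<and> t \<in> T. a (card T))"
    by (rule sum.swap_restrict) auto
  also have "\<dots> = (\<Sum>T\<in>Pow {..<r}. real (card T) * a (card T))"
  proof (rule sum.cong)
    fix T assume "T \<in> Pow {..<r}"
    then have "{t. t \<in> {..<r} \<and> t \<in> T} = T" by auto
    then show "(\<Sum>t | t \<in> {..<r} \<and> t \<in> T. a (card T)) = real (card T) * a (card T)" by simp
  qed simp
  finally show ?thesis using assms by (simp add: field_simps)
qed

lemma sum_cube01_powr:
  "(\<Sum>x\<in>cube01 d. 2 powr (\<Sum>j<d. w j * x j)) = (\<Prod>j<d. 1 + 2 powr w j)"
proof -
  let ?\<iota> = "\<lambda>A i. if i \<in> A then 1 else 0 :: real"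
  have "(\<Sum>x\<in>cube01 d. 2 powr (\<Sum>j<d. w j * x j))
      = (\<Sum>A\<in>Pow {..<d}. 2 powr (\<Sum>j<d. w j * ?\<iota> A j))"
    by (rule sum.reindex_bij_betw[OF bij_betw_Pow_cube01, symmetric])
  also have "\<dots> = (\<Sum>A\<in>Pow {..<d}. (\<Prod>j\<in>A. 2 powr w j) * (\<Prod>j\<in>{..<d} - A. 1))"
  proof (rule sum.cong)
    fix A assume A: "A \<in> Pow {..<d}"
    have "(\<Sum>j<d. w j * ?\<iota> A j) = (\<Sum>j\<in>A. w j)"
      using A by (intro sum.mono_neutral_cong_right) auto
    then show "2 powr (\<Sum>j<d. w j * ?\<iota> A j) = (\<Prod>j\<in>A. 2 powr w j) * (\<Prod>j\<in>{..<d} - A. 1)"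
      by (simp add: powr_sum)
  qed simp
  also have "\<dots> = (\<Prod>j<d. 2 powr w j + 1)" by (rule prod_add[symmetric]) simp
  finally show ?thesis by (simp add: add.commute)
qed

text \<open>Chernoff's method: every counted point has 2 powr (f x - \<kappa>) \<ge> 1, and the sum
  of these terms over the whole cube factorizes.\<close>

lemma card_cube01_linear_ge_le:
  "real (card {x \<in> cube01 d. (\<Sum>j<d. w j * x j) \<ge> \<kappa>}) \<le> 2 powr ((\<Sum>j<d. log 2 (1 + 2 powr w j)) - \<kappa>)"
proof -
  let ?f = "\<lambda>x. \<Sum>j<d. w j * x j"
  have "real (card {x \<in> cube01 d. ?f x \<ge> \<kappa>}) = (\<Sum>x\<in>{x \<in> cube01 d. ?f x \<ge> \<kappa>}. 1)" by simp
  also have "\<dots> \<le> (\<Sum>x\<in>{x \<in> cube01 d. ?f x \<ge> \<kappa>}. 2 powr (?f x - \<kappa>))"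
    by (intro sum_mono) (auto intro: ge_one_powr_ge_zero)
  also have "\<dots> \<le> (\<Sum>x\<in>cube01 d. 2 powr (?f x - \<kappa>))"
    using finite_cube01 by (intro sum_mono2) auto
  also have "\<dots> = (\<Prod>j<d. 1 + 2 powr w j) / 2 powr \<kappa>"
    by (simp add: powr_diff sum_divide_distrib[symmetric] sum_cube01_powr)
  also have "(\<Prod>j<d. 1 + 2 powr w j) = (\<Prod>j<d. 2 powr log 2 (1 + 2 powr w j))"
    by (intro prod.cong) (auto simp: add_pos_pos)
  also have "\<dots> = 2 powr (\<Sum>j<d. log 2 (1 + 2 powr w j))" by (simp add: powr_sum)
  finally show ?thesis by (simp add: powr_diff)
qed

text \<open>
  For \<open>0 < i < r\<close> the weight is the log-likelihood ratio of the Bernoulli distribution with mean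
  \<open>i / r\<close>, for which \<open>\<xi> \<mapsto> log (1 + 2\<^sup>a) - \<xi> a\<close> takes the entropy as its value at \<open>\<xi> = i / r\<close>.
  On the constant columns a large \<open>M\<close> penalizes leaving the smallest face of the cube.
\<close>

definition column_weight :: "real \<Rightarrow> nat \<Rightarrow> nat \<Rightarrow> real" where
  "column_weight M r i = (if i = 0 then - M else if i = r then M else log 2 (real i / real (r - i)))"

text \<open>For 0 < i < r the left side is the entropy itself. For i = 0 and i = r the entropy is 0
  and the left side is exactly the error term, which is small for large M.\<close>

lemma column_weight_entropy:
  assumes "i \<le> r" "0 < r"
  shows "log 2 (1 + 2 powr column_weight M r i) - i / r * column_weight M r i
    \<le> binary_entropy (i / r) + log 2 (1 + 2 powr - M)"
proof -
  have pos: "0 \<le> log 2 (1 + 2 powr - M)" by (subst zero_le_log_cancel_iff) (auto intro: add_pos_pos)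
  consider "i = 0" | "i = r" | "0 < i" "i < r" using assms by linarith
  then show ?thesis
  proof cases
    case 2
    have "1 + 2 powr M = 2 powr M * (1 + 2 powr - M)" by (simp add: distrib_left flip: powr_add)
    then have "log 2 (1 + 2 powr M) = M + log 2 (1 + 2 powr - M)"
      using add_pos_nonneg[OF zero_less_one powr_ge_zero, of 2 "- M"] by (simp add: log_mult)
    then show ?thesis using 2 assms by (simp add: column_weight_def)
  next
    case 3
    define i' where "i' = real r - real i"
    have i': "i' > 0" "real (r - i) = i'" "real r = real i + i'" using 3 by (auto simp: i'_def of_nat_diff)
    have w: "column_weight M r i = log 2 (i / i')" using 3 i' by (simp add: column_weight_def)
    have "1 + 2 powr log 2 (i / i') = r / i'" using 3 i' by (simp add: field_simps)
    then have 1: "log 2 (1 + 2 powr log 2 (i / i')) = log 2 r - log 2 i'" using 3 i'(1) by (simp add: log_divide)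
    have 2: "log 2 (i / i') = log 2 i - log 2 i'" using 3 i' by (simp add: log_divide)
    have 4: "1 - i / r = i' / r" using 3 i'(1) by (simp add: field_simps i'_def)
    have 5: "log 2 (1 / (i / r)) = log 2 r - log 2 i" "log 2 (1 / (i' / r)) = log 2 r - log 2 i'"
      using 3 i'(1) by (simp_all add: log_divide)
    have "binary_entropy (i / r) = i / r * (log 2 r - log 2 i) + i' / r * (log 2 r - log 2 i')"
      unfolding binary_entropy_def 4 5 ..
    also have "\<dots> = (i / r + i' / r) * log 2 r - i' / r * log 2 i' - i / r * log 2 i"
      by (simp add: algebra_simps)
    also have "i / r + i' / r = 1" using 4 by linarith
    also have "i' / r = 1 - i / r" using 4 by simp
    finally have "binary_entropy (i / r) = log 2 r - log 2 i' - i / r * (log 2 i - log 2 i')"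
      by (simp add: algebra_simps)
    then show ?thesis using pos unfolding w 1 by (simp add: 2)
  qed (simp_all add: column_weight_def)
qed

text \<open>Two errors of \<eta> / 2 are controlled in turn: M is chosen for the constant columns,
  then \<delta> for the rescaling, by continuity at 1 of the finitely many functions
  \<open>\<phi> T\<close>. Thus \<delta> is fixed before d and c.\<close>

lemma supporting_functional:
  assumes k: "k \<ge> 1" and \<eta>: "\<eta> > 0"
  shows "\<exists>\<delta>. 0 < \<delta> \<and> \<delta> < 1 \<and> (\<forall>d c. 0 < d \<longrightarrow> typical d (k + 1) \<delta> c \<longrightarrow>
    (\<exists>f. \<exists>\<kappa>::real. linear f \<and> (\<forall>s<k + 1. f (col_point d c s) = \<kappa>) \<and>
      real (card {x \<in> cube01 d. f x \<ge> \<kappa>}) \<le> 2 powr ((1 - \<tau> k + \<eta>) * d)))"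
proof -
  define r where "r = k + 1"
  have r: "0 < r" by (simp add: r_def)
  have "((\<lambda>M. log 2 (1 + 2 powr - M)) \<longlongrightarrow> log 2 (1 + 0)) at_top"
  proof (intro tendsto_intros)
    show "((\<lambda>M::real. 2 powr - M) \<longlongrightarrow> 0) at_top"
      by (real_asymp)
  qed auto
  then have "\<forall>\<^sub>F M in at_top. log 2 (1 + 2 powr - M) < \<eta> / 2"
    using \<eta> by (intro order_tendstoD(2)) auto
  then obtain M where M: "log 2 (1 + 2 powr - M) < \<eta> / 2"
    using eventually_happens trivial_limit_at_top_linorder by blast
  define \<alpha> where "\<alpha> T = column_weight M r (card T)" for T :: "nat set"
  \<comment> \<open>A class of u D coordinates, each of weight \<alpha> T / u, contributes D times
    this value to the Chernoff exponent; u = 1 is the ideal class size.\<close>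
  define \<phi> where "\<phi> T u = u * log 2 (1 + 2 powr (\<alpha> T / u))" for T and u :: real
  have "\<forall>\<^sub>F u in nhds 1. \<forall>T\<in>Pow {..<r}. \<phi> T u < \<phi> T 1 + \<eta> / 2"
  proof (intro eventually_ball_finite ballI)
    fix T
    have "isCont (\<phi> T) 1" unfolding \<phi>_def[abs_def]
      by (intro continuous_intros) (auto simp: add_pos_pos add_nonneg_eq_0_iff)
    then have "(\<phi> T \<longlongrightarrow> \<phi> T 1) (nhds 1)" by (simp add: isCont_def tendsto_at_iff_tendsto_nhds)
    then show "\<forall>\<^sub>F u in nhds 1. \<phi> T u < \<phi> T 1 + \<eta> / 2" using \<eta> by (intro order_tendstoD(2)) auto
  qed simp
  then obtain \<rho> where \<rho>: "\<rho> > 0" "\<And>u T. \<bar>u - 1\<bar> < \<rho> \<Longrightarrow> T \<subseteq> {..<r} \<Longrightarrow> \<phi> T u < \<phi> T 1 + \<eta> / 2"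
    unfolding eventually_nhds_metric dist_real_def by auto
  define \<delta> where "\<delta> = min (\<rho> / 2) (1 / 2)"
  have \<delta>: "0 < \<delta>" "\<delta> < 1" "\<delta> < \<rho>" using \<rho>(1) by (auto simp: \<delta>_def)
  have "\<exists>f. \<exists>\<kappa>::real. linear f \<and> (\<forall>s<r. f (col_point d c s) = \<kappa>) \<and>
      real (card {x \<in> cube01 d. f x \<ge> \<kappa>}) \<le> 2 powr ((1 - \<tau> k + \<eta>) * d)"
    if d: "0 < d" and tc: "typical d r \<delta> c" for d c
  proof -
    define D where "D = real d / 2 ^ r"
    have D: "D > 0" using d by (simp add: D_def)
    define N where "N T = real (col_count d c T)" for T
    have cj: "c j \<subseteq> {..<r}" if "j < d" for j using tc that by (simp add: typical_def)
    have u: "\<bar>N T / D - 1\<bar> \<le> \<delta>" if "T \<subseteq> {..<r}" for T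
    proof -
      have "\<bar>N T - D\<bar> \<le> \<delta> * D" using tc that by (simp add: typical_def N_def D_def)
      moreover have "N T / D - 1 = (N T - D) / D" using D by (simp add: field_simps)
      ultimately show ?thesis using D by (simp add: abs_divide divide_le_eq)
    qed
    have N: "N T > 0" if "T \<subseteq> {..<r}" for T
    proof -
      have "0 < N T / D" using u[OF that] \<delta> by linarith
      then show ?thesis using D by (simp add: zero_less_divide_iff)
    qed
    \<comment> \<open>The divisor gives class T the total weight D \<alpha> T whatever its actual
      size, so that the value at a vertex is that of the ideal class sizes.\<close>
    define w where "w j = \<alpha> (c j) / (N (c j) / D)" for j
    define f where "f x = (\<Sum>j<d. w j * x j)" for x :: "nat \<Rightarrow> real"
    define \<kappa> where "\<kappa> = D * (\<Sum>T\<in>Pow {..<r}. card T / r * \<alpha> T)"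
    have "f (col_point d c s) = \<kappa>" if s: "s < r" for s
    proof -
      have "f (col_point d c s) = (\<Sum>j<d. if s \<in> c j then \<alpha> (c j) / (N (c j) / D) else 0)"
        unfolding f_def by (intro sum.cong) (auto simp: col_point_def w_def)
      also have "\<dots> = (\<Sum>T\<in>Pow {..<r}. N T * (if s \<in> T then \<alpha> T / (N T / D) else 0))"
        unfolding N_def by (rule sum_columns[OF cj])
      also have "\<dots> = (\<Sum>T\<in>Pow {..<r}. if s \<in> T then D * \<alpha> T else 0)"
        using N by (intro sum.cong) (auto simp: less_le)
      also have "\<dots> = D * (\<Sum>T | T \<subseteq> {..<r} \<and> s \<in> T. \<alpha> T)"
        by (simp add: sum_distrib_left flip: sum.inter_filter)
      also have "(\<Sum>T | T \<subseteq> {..<r} \<and> s \<in> T. \<alpha> T) = (\<Sum>T\<in>Pow {..<r}. card T / r * \<alpha> T)"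
        unfolding \<alpha>_def by (subst sum_Pow_containing_card[OF s]) (simp add: sum_divide_distrib)
      finally show ?thesis by (simp add: \<kappa>_def)
    qed
    moreover have "linear f" unfolding f_def by (rule linear_weighted_sum)
    moreover have "real (card {x \<in> cube01 d. f x \<ge> \<kappa>}) \<le> 2 powr ((1 - \<tau> k + \<eta>) * d)"
    proof -
      have "(\<Sum>j<d. log 2 (1 + 2 powr w j)) - \<kappa>
          = (\<Sum>T\<in>Pow {..<r}. N T * log 2 (1 + 2 powr (\<alpha> T / (N T / D)))) - \<kappa>"
        unfolding N_def w_def by (subst sum_columns[OF cj, symmetric]) auto
      also have "\<dots> = D * (\<Sum>T\<in>Pow {..<r}. \<phi> T (N T / D) - card T / r * \<alpha> T)"
        using D by (simp add: \<kappa>_def sum_subtractf right_diff_distrib \<phi>_def sum_distrib_left)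
      also have "\<dots> \<le> D * (\<Sum>T\<in>Pow {..<r}. binary_entropy (card T / r) + \<eta>)"
      proof (intro mult_left_mono sum_mono)
        fix T assume T: "T \<in> Pow {..<r}"
        then have "card T \<le> r" using card_mono[of "{..<r}" T] by simp
        then have "\<phi> T 1 - card T / r * \<alpha> T \<le> binary_entropy (card T / r) + log 2 (1 + 2 powr - M)"
          unfolding \<phi>_def \<alpha>_def using column_weight_entropy[OF _ r, of "card T" M] by simp
        moreover have "\<phi> T (N T / D) < \<phi> T 1 + \<eta> / 2"
          using u[of T] T \<delta> by (intro \<rho>(2)) auto
        ultimately show "\<phi> T (N T / D) - card T / r * \<alpha> T \<le> binary_entropy (card T / r) + \<eta>"
          using M by linarith
      qed (use D in simp)
      also have "\<dots> = (1 - \<tau> k + \<eta>) * d"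
        unfolding one_minus_\<tau>[OF k] D_def r_def
        by (simp add: sum.distrib card_Pow algebra_simps add_divide_distrib)
      finally show ?thesis
        unfolding f_def using card_cube01_linear_ge_le[where d = d and w = w and \<kappa> = \<kappa>]
        by (meson order_trans powr_mono one_le_numeral)
    qed
    ultimately show ?thesis by blast
  qed
  then show ?thesis using \<delta> unfolding r_def by blast
qed

subsection \<open>The two regimes\<close>

text \<open>One factor \<open>2 ^ r\<close> comes from the union over column sets, two more from the
  squared deviation \<delta> d / 2^r, and \<open>r ^ r\<close> from (2^d / r)^r \<le>
  \<open>2 ^ d choose r\<close>.\<close>

lemma not_typical_fraction_le:
  assumes "0 < \<delta>" "0 < d" "0 < r" "r \<le> 2 ^ d"
  shows "real (card {S \<in> {S. \<not> (\<exists>c. typical d r \<delta> c \<and> S = col_point d c ` {..<r})}. S \<subseteq> cube01 d \<and> card S = r})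
    / real (2 ^ d choose r) \<le> 2 ^ (3 * r) * real r ^ r / (\<delta>\<^sup>2 * d)"
proof -
  let ?B = "{S \<in> {S. \<not> (\<exists>c. typical d r \<delta> c \<and> S = col_point d c ` {..<r})}. S \<subseteq> cube01 d \<and> card S = r}"
  have "?B = {S. S \<subseteq> cube01 d \<and> card S = r \<and> \<not> (\<exists>c. typical d r \<delta> c \<and> S = col_point d c ` {..<r})}"
    by blast
  then have B: "real (card ?B) \<le> 2 ^ r * (real d * (2 ^ r) ^ d / (\<delta> * (real d / 2 ^ r))\<^sup>2)"
    using card_not_typical_subsets_le[OF assms(1,2), of r] by (simp only:)
  have C: "(2 ^ d / real r) ^ r \<le> real (2 ^ d choose r)"
    using binomial_ge_n_over_k_pow_k[OF assms(4), where ?'a = real] by simp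
  have pos: "0 < (2 ^ d / real r) ^ r" using assms by simp
  have "real (card ?B) / real (2 ^ d choose r)
      \<le> (2 ^ r * (real d * (2 ^ r) ^ d / (\<delta> * (real d / 2 ^ r))\<^sup>2)) / (2 ^ d / real r) ^ r"
    using B C pos by (intro frac_le) auto
  also have "\<dots> = 2 ^ (3 * r) * real r ^ r / (\<delta>\<^sup>2 * d)"
  proof -
    have "(2 ^ r) ^ d = ((2::real) ^ d) ^ r" by (simp add: power_mult[symmetric] mult.commute)
    moreover have "(2::real) ^ (3 * r) = 2 ^ r * (2 ^ r)\<^sup>2"
      by (simp add: power_add[symmetric] power_mult[symmetric])
    ultimately show ?thesis
      using assms by (simp add: field_simps power2_eq_square)
  qed
  finally show ?thesis .
qed

lemma convex_hull_face_of_convex_hull: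
  fixes f :: "'a::real_vector \<Rightarrow> real"
  assumes W: "finite W" "S \<subseteq> W" and f: "linear f"
    and S: "\<And>v. v \<in> S \<Longrightarrow> f v = \<kappa>" and less: "\<And>w. w \<in> W - S \<Longrightarrow> f w < \<kappa>"
  shows "convex hull S face_of convex hull W"
proof (rule face_of_convex_hulls[OF W])
  interpret linear f by fact
  have "affine {x. f x = \<kappa>}"
    by (auto simp: affine_def add scale simp flip: distrib_right)
  then have "affine hull S \<subseteq> {x. f x = \<kappa>}" using S by (intro hull_minimal) auto
  moreover have "convex hull (W - S) \<subseteq> {x. f x < \<kappa>}"
    using less by (intro hull_minimal convex_linear_less f) auto
  ultimately show "affine hull S \<inter> convex hull (W - S) = {}" by fastforce
qed

text \<open>For typical S only the points of \<open>?A\<close> can spoil the face. The expected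
  number of them in W is at most 2 to the power (1 - \<tau> k + \<epsilon> / 2) d + (\<tau> k -
  \<epsilon>) d - d, which is - (\<epsilon> / 2) d.\<close>

lemma expected_face_density_lower:
  assumes k: "k \<ge> 1" and \<epsilon>: "\<epsilon> > 0"
  shows "\<exists>\<delta>::real. \<delta> > 0 \<and> (\<forall>d m. 0 < d \<longrightarrow> k + 1 \<le> m \<longrightarrow> m \<le> 2 ^ d \<longrightarrow> real m \<le> 2 powr ((\<tau> k - \<epsilon>) * d) \<longrightarrow>
    1 - expected_face_density k d m
      \<le> 2 ^ (3 * (k + 1)) * real (k + 1) ^ (k + 1) / (\<delta>\<^sup>2 * d) + 2 powr (- (\<epsilon> / 2) * d))"
proof -
  let ?r = "k + 1"
  obtain \<delta> where \<delta>: "0 < \<delta>" "\<delta> < 1" and sf: "\<And>d c. 0 < d \<Longrightarrow> typical d ?r \<delta> c \<Longrightarrow>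
    \<exists>f. \<exists>\<kappa>::real. linear f \<and> (\<forall>s<?r. f (col_point d c s) = \<kappa>) \<and>
      real (card {x \<in> cube01 d. f x \<ge> \<kappa>}) \<le> 2 powr ((1 - \<tau> k + \<epsilon> / 2) * d)"
    using supporting_functional[OF k, of "\<epsilon> / 2"] \<epsilon> by auto
  have bound: "1 - expected_face_density k d m
      \<le> 2 ^ (3 * ?r) * real ?r ^ ?r / (\<delta>\<^sup>2 * d) + 2 powr (- (\<epsilon> / 2) * d)"
    if d: "0 < d" and m: "?r \<le> m" "m \<le> 2 ^ d" "real m \<le> 2 powr ((\<tau> k - \<epsilon>) * d)" for d m
  proof -
    let ?B = "{S. \<not> (\<exists>c. typical d ?r \<delta> c \<and> S = col_point d c ` {..<?r})}"
    have "1 - expected_face_density k d m \<le>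
        real (card {S \<in> ?B. S \<subseteq> cube01 d \<and> card S = ?r}) / real (2 ^ d choose ?r) + 2 powr (- (\<epsilon> / 2) * d)"
    proof (rule expected_face_density_ge[OF m(1,2)])
      fix S assume S: "S \<subseteq> cube01 d" "card S = ?r" "S \<notin> ?B"
      then obtain c where c: "typical d ?r \<delta> c" "S = col_point d c ` {..<?r}" by blast
      obtain f :: "(nat \<Rightarrow> real) \<Rightarrow> real" and \<kappa> where f: "linear f" "\<And>s. s < ?r \<Longrightarrow> f (col_point d c s) = \<kappa>"
        "real (card {x \<in> cube01 d. f x \<ge> \<kappa>}) \<le> 2 powr ((1 - \<tau> k + \<epsilon> / 2) * d)"
        using sf[OF d c(1)] by blast
      let ?A = "{x \<in> cube01 d. f x \<ge> \<kappa>} - S"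
      let ?C = "real ((2 ^ d - ?r) choose (m - ?r))"
      have indep: "\<not> affine_dependent S"
        unfolding c(2) using typical_dual_coordinates[OF c(1) \<delta>(2) d]
        by (rule affine_independent_dual_coordinates)
      have "convex hull S face_of convex hull W" if "S \<subseteq> W" "W \<subseteq> cube01 d" "W \<inter> ?A = {}" for W
      proof (rule convex_hull_face_of_convex_hull[OF _ _ f(1)])
        show "finite W" using that finite_cube01 finite_subset by blast
        show "f w < \<kappa>" if "w \<in> W - S" for w using that \<open>W \<subseteq> cube01 d\<close> \<open>W \<inter> ?A = {}\<close> by force
      qed (use that f(2) c(2) in auto)
      then have "{W. S \<subseteq> W \<and> W \<subseteq> cube01 d \<and> card W = m \<and> \<not> (\<not> affine_dependent S \<and> convex hull S face_of convex hull W)}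
          \<subseteq> {W. S \<subseteq> W \<and> W \<subseteq> cube01 d \<and> card W = m \<and> W \<inter> ?A \<noteq> {}}" using indep by blast
      then have "card {W. S \<subseteq> W \<and> W \<subseteq> cube01 d \<and> card W = m \<and> \<not> (\<not> affine_dependent S \<and> convex hull S face_of convex hull W)}
          \<le> card {W. S \<subseteq> W \<and> W \<subseteq> cube01 d \<and> card W = m \<and> W \<inter> ?A \<noteq> {}}"
        by (intro card_mono) (auto intro: finite_subset[of _ "Pow (cube01 d)"] simp: finite_cube01)
      also have "real \<dots> \<le> card ?A * m / card (cube01 d) * real ((card (cube01 d) - card S) choose (m - card S))"
        using S m by (intro card_supersets_hitting_le finite_cube01) (auto simp: card_cube01)
      also have "\<dots> = card ?A * m / 2 ^ d * ?C" by (simp only: card_cube01 S(2) of_nat_power of_nat_numeral)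
      also have "\<dots> \<le> 2 powr (- (\<epsilon> / 2) * d) * ?C"
      proof (rule mult_right_mono)
        have "card ?A \<le> card {x \<in> cube01 d. f x \<ge> \<kappa>}" using finite_cube01 by (intro card_mono) auto
        then have "real (card ?A) \<le> 2 powr ((1 - \<tau> k + \<epsilon> / 2) * d)" using f(3) by linarith
        then have "card ?A * real m \<le> 2 powr ((1 - \<tau> k + \<epsilon> / 2) * d) * 2 powr ((\<tau> k - \<epsilon>) * d)"
          using m(3) by (intro mult_mono) auto
        also have "\<dots> = 2 powr (- (\<epsilon> / 2) * d) * 2 powr real d"
          by (simp add: algebra_simps flip: powr_add)
        finally show "card ?A * m / 2 ^ d \<le> 2 powr (- (\<epsilon> / 2) * d)"
          by (simp add: divide_le_eq powr_realpow)
      qed simp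
      finally show "real (card {W. S \<subseteq> W \<and> W \<subseteq> cube01 d \<and> card W = m \<and>
          \<not> (\<not> affine_dependent S \<and> convex hull S face_of convex hull W)}) \<le> 2 powr (- (\<epsilon> / 2) * d) * ?C"
        by simp
    qed simp
    also have "real (card {S \<in> ?B. S \<subseteq> cube01 d \<and> card S = ?r}) / real (2 ^ d choose ?r)
        \<le> 2 ^ (3 * ?r) * real ?r ^ ?r / (\<delta>\<^sup>2 * d)"
      using m \<delta> d by (intro not_typical_fraction_le) auto
    finally show ?thesis by simp
  qed
  show ?thesis by (intro exI[of _ \<delta>] conjI allI impI bound \<delta>(1))
qed

text \<open>Otherwise F would cut a nonempty face out of the hull of W - S, and that face would
  contain a point of W - S. Such a point lies in the affine hull of S and in the cube, hence in
  S.\<close>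

lemma barycenter_not_in_convex_hull:
  assumes W: "W \<subseteq> cube01 d" "S \<subseteq> W" "finite S" "S \<noteq> {}"
    and F: "F face_of convex hull W" "S \<subseteq> F" "F \<subseteq> affine hull S"
    and S: "affine hull S \<inter> cube01 d \<subseteq> S"
    and b: "b \<in> convex hull S"
  shows "b \<notin> convex hull (W - S)"
proof
  assume b': "b \<in> convex hull (W - S)"
  have "b \<in> F" using b F(2) face_of_imp_convex[OF F(1)] by (meson hull_minimal subsetD)
  have "(F \<inter> convex hull (W - S)) face_of (convex hull W \<inter> convex hull (W - S))"
    using F(1) by (rule face_of_slice) simp
  moreover have "convex hull W \<inter> convex hull (W - S) = convex hull (W - S)"
    by (intro Int_absorb1 hull_mono) auto
  ultimately have "(F \<inter> convex hull (W - S)) face_of convex hull (W - S)" by simp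
  from face_of_convex_hull_eq[OF this] have "F \<inter> convex hull (W - S) \<inter> (W - S) \<noteq> {}"
    using b' \<open>b \<in> F\<close> by (metis IntI convex_hull_empty empty_iff)
  then obtain w where "w \<in> F" "w \<in> W - S" by blast
  then show False using F(3) S W(1) by blast
qed

text \<open>The half-space separating b from W - S depends on W, so the bound \<open>each\<close>
  for a single trace H is summed over all traces. The bound on d is uniform in m because m will be
  \<open>n d\<close>.\<close>

lemma expected_face_density_upper:
  assumes k: "k \<ge> 1" and \<epsilon>: "\<epsilon> > 0"
  shows "\<exists>\<delta>::real. \<delta> > 0 \<and> (\<forall>\<^sub>F d in sequentially. \<forall>m. m \<le> 2 ^ d \<longrightarrow> real m \<ge> 2 powr ((\<tau> k + \<epsilon>) * d) \<longrightarrow>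
    expected_face_density k d m
      \<le> 2 ^ (3 * (k + 1)) * real (k + 1) ^ (k + 1) / (\<delta>\<^sup>2 * d)
        + ((2 ^ d) ^ d + 1) * exp (- (2 powr (\<epsilon> / 2 * d) / (8 * real (k + 1)))))"
proof -
  let ?r = "k + 1"
  \<comment> \<open>The deviation of the column counts and that of the log-probability each cost at
    most \<epsilon> / 4 in the exponent, which gives the \<epsilon> / 2 in
    \<open>L d\<close>.\<close>
  define \<delta> where "\<delta> = min (\<epsilon> / 4) (1 / 2)"
  have \<delta>: "0 < \<delta>" "\<delta> < 1" "\<delta> \<le> \<epsilon> / 4" using \<epsilon> by (auto simp: \<delta>_def)
  define L where "L d = 2 powr ((1 - \<tau> k - \<epsilon> / 2) * d) / (2 * real ?r)" for d :: nat
  have bound: "expected_face_density k d m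
      \<le> 2 ^ (3 * ?r) * real ?r ^ ?r / (\<delta>\<^sup>2 * d)
        + ((2 ^ d) ^ d + 1) * exp (- (2 powr (\<epsilon> / 2 * d) / (8 * real ?r)))"
    if d: "0 < d" "2 * ?r * (log 2 ?r)\<^sup>2 \<le> (\<epsilon> / 4)\<^sup>2 * d"
      and m: "m \<le> 2 ^ d" "real m \<ge> 2 powr ((\<tau> k + \<epsilon>) * d)"
      and large: "real m \<ge> 2 * ?r" "L d \<ge> 2 * ?r" for d m
  proof -
    let ?B = "{S. \<not> (\<exists>c. typical d ?r \<delta> c \<and> S = col_point d c ` {..<?r})}"
    let ?p = "((2 ^ d) ^ d + 1) * exp (- (2 powr (\<epsilon> / 2 * d) / (8 * real ?r)))"
    have "2 * ?r \<le> m" using large(1) by (simp only: of_nat_le_iff)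
    then have m': "?r \<le> m" "?r < 2 ^ d" using m(1) by auto
    have "expected_face_density k d m \<le>
        real (card {S \<in> ?B. S \<subseteq> cube01 d \<and> card S = ?r}) / real (2 ^ d choose ?r) + ?p"
    proof (rule expected_face_density_le[OF m'(1) m(1)])
      fix S assume S: "S \<subseteq> cube01 d" "card S = ?r" "S \<notin> ?B"
      then obtain c where c: "typical d ?r \<delta> c" "S = col_point d c ` {..<?r}" by blast
      have cj: "c j \<subseteq> {..<?r}" if "j < d" for j using c(1) that by (simp add: typical_def)
      have fin: "finite S" "S \<noteq> {}" using S(2) by (auto intro: card_ge_0_finite)
      define b where "b = (1 / real ?r) *\<^sub>R (\<Sum>s<?r. col_point d c s)"
      let ?Fam = "{A. \<exists>f. linear f \<and> A = {x \<in> cube01 d. f x \<ge> (f b :: real)}}"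
      let ?C = "real ((2 ^ d - ?r) choose (m - ?r))"
      let ?E = "(\<lambda>j i. if i = j then 1 else 0 :: real) ` {..<d}"
      have inj: "inj_on (col_point d c) {..<?r}" using S(2) c(2) by (intro eq_card_imp_inj_on) auto
      have b_hull: "b \<in> convex hull S"
      proof -
        have "(\<Sum>v\<in>S. (1 / real ?r) *\<^sub>R v) = (\<Sum>s<?r. (1 / real ?r) *\<^sub>R col_point d c s)"
          unfolding c(2) by (rule sum.reindex[OF inj, unfolded o_def])
        then have "b = (\<Sum>v\<in>S. (1 / real ?r) *\<^sub>R v)"
          unfolding b_def by (simp only: scaleR_sum_right)
        then show ?thesis unfolding convex_hull_finite[OF fin(1)] using S(2)
          by (auto intro!: exI[of _ "\<lambda>_. 1 / real ?r"])
      qed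
      have span: "x \<in> span ?E" if "x \<in> cube01 d" for x
        using that by (intro span_unit_vectors) (auto simp: cube01_iff)
      have "b \<in> span ?E"
        unfolding b_def by (intro span_scale span_sum span col_point_in_cube01)
      then have "card ?Fam \<le> card (cube01 d) ^ card ?E + 1"
        using span finite_cube01 by (intro card_halfspace_traces_le) auto
      also have "card ?E \<le> d" using card_image_le[of "{..<d}" "\<lambda>j i. if i = j then 1 else 0 :: real"] by simp
      then have "card (cube01 d) ^ card ?E + 1 \<le> (2 ^ d) ^ d + 1"
        unfolding card_cube01 by (intro add_right_mono power_increasing) auto
      finally have Fam: "card ?Fam \<le> (2 ^ d) ^ d + 1" .
      have finFam: "finite ?Fam"
        by (rule finite_subset[of _ "Pow (cube01 d)"]) (auto simp: finite_cube01)
      have hullS: "affine hull S \<inter> cube01 d \<subseteq> S"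
        unfolding c(2)
        using affine_hull_dual_coordinates_cube01[OF _ typical_dual_coordinates[OF c(1) \<delta>(2) d(1)]] by auto
      have sub: "{W. S \<subseteq> W \<and> W \<subseteq> cube01 d \<and> card W = m \<and> (\<exists>F. F face_of convex hull W \<and> S \<subseteq> F \<and> F \<subseteq> affine hull S)}
          \<subseteq> (\<Union>H\<in>?Fam. {W. S \<subseteq> W \<and> W \<subseteq> cube01 d \<and> card W = m \<and> W \<inter> (H - S) = {}})"
      proof
        fix W assume "W \<in> {W. S \<subseteq> W \<and> W \<subseteq> cube01 d \<and> card W = m \<and> (\<exists>F. F face_of convex hull W \<and> S \<subseteq> F \<and> F \<subseteq> affine hull S)}"
        then obtain F where W: "S \<subseteq> W" "W \<subseteq> cube01 d" "card W = m"
          and F: "F face_of convex hull W" "S \<subseteq> F" "F \<subseteq> affine hull S" by blast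
        have "finite (W - S)" using W finite_cube01 finite_subset by blast
        moreover have "b \<notin> convex hull (W - S)"
          by (rule barycenter_not_in_convex_hull[OF W(2,1) fin F hullS b_hull])
        ultimately obtain f where f: "linear f" "\<forall>w\<in>W - S. f w < (f b :: real)"
          using not_in_convex_hull_imp_linear_less by blast
        have "w \<in> S" if "w \<in> W" "f b \<le> f w" for w using f(2) that by (metis DiffI not_le)
        then have "W \<inter> ({x \<in> cube01 d. f x \<ge> f b} - S) = {}" by blast
        moreover have "{x \<in> cube01 d. f x \<ge> f b} \<in> ?Fam" using f(1) by blast
        ultimately show "W \<in> (\<Union>H\<in>?Fam. {W. S \<subseteq> W \<and> W \<subseteq> cube01 d \<and> card W = m \<and> W \<inter> (H - S) = {}})"
          using W by blast
      qed
      have each: "real (card {W. S \<subseteq> W \<and> W \<subseteq> cube01 d \<and> card W = m \<and> W \<inter> (H - S) = {}})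
          \<le> exp (- (2 powr (\<epsilon> / 2 * d) / (8 * real ?r))) * ?C" if H: "H \<in> ?Fam" for H
      proof -
        obtain f :: "(nat \<Rightarrow> real) \<Rightarrow> real" where f: "linear f" "H = {x \<in> cube01 d. f x \<ge> f b}" using H by blast
        have "2 powr ((\<Sum>j<d. binary_entropy (card (c j) / real ?r)) - \<epsilon> / 4 * d) / (2 * real ?r) \<le> real (card H)"
          unfolding f(2) using \<epsilon> d cj f(1) b_def by (intro card_halfspace_ge) auto
        moreover have "L d \<le> 2 powr ((\<Sum>j<d. binary_entropy (card (c j) / real ?r)) - \<epsilon> / 4 * d) / (2 * real ?r)"
        proof -
          have "(1 - \<tau> k - \<epsilon> / 2) * d \<le> (1 - \<tau> k - \<delta> - \<epsilon> / 4) * d"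
            using \<delta> by (intro mult_right_mono) auto
          also have "\<dots> = (1 - \<tau> k - \<delta>) * d - \<epsilon> / 4 * d" by (simp add: algebra_simps)
          also have "\<dots> \<le> (\<Sum>j<d. binary_entropy (card (c j) / real ?r)) - \<epsilon> / 4 * d"
            using typical_entropy_ge[OF k c(1)] \<delta> by (intro diff_right_mono) auto
          finally show ?thesis unfolding L_def by (intro divide_right_mono powr_mono) auto
        qed
        ultimately have "L d \<le> real (card H)" by linarith
        moreover have "real (card H) \<le> real (card (H - S)) + real ?r"
        proof -
          have "card H \<le> card (H - S) + ?r"
            using diff_card_le_card_Diff[OF fin(1), of H] S(2) by linarith
          then show ?thesis by linarith
        qed
        moreover have "2 * real ?r \<le> L d" using large(2) by simp
        moreover have "l / 2 \<le> x" if "l \<le> y" "y \<le> x + q" "2 * q \<le> l" for l x y q :: real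
          using that by linarith
        ultimately have cH: "L d / 2 \<le> real (card (H - S))" by blast
        have mr: "real m / 2 \<le> real (m - ?r)" using large(1) m'(1) by (simp add: of_nat_diff)
        have q: "real m / 2 / 2 ^ d \<le> real (m - ?r) / real (2 ^ d - ?r)"
        proof (rule frac_le[OF _ mr])
          show "0 < real (2 ^ d - ?r)" using m'(2) by (simp only: of_nat_0_less_iff zero_less_diff)
          have "real (2 ^ d - ?r) \<le> real (2 ^ d)" by (intro of_nat_mono) simp
          then show "real (2 ^ d - ?r) \<le> 2 ^ d" by simp
        qed simp
        \<comment> \<open>The constant collects 2 r from \<open>L d\<close>, a factor 2 from passing
          from H to H - S, and another 2 from passing from m to m - r.\<close>
        have "2 powr (\<epsilon> / 2 * d) / (8 * real ?r) = 2 powr ((1 - \<tau> k - \<epsilon> / 2) * d) * 2 powr ((\<tau> k + \<epsilon>) * d) / 2 powr d / (8 * real ?r)"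
          by (simp add: algebra_simps flip: powr_add powr_diff)
        also have "\<dots> = L d / 2 * (2 powr ((\<tau> k + \<epsilon>) * d) / 2 / 2 ^ d)"
          by (simp add: L_def powr_realpow)
        also have "\<dots> \<le> L d / 2 * (real m / 2 / 2 ^ d)"
          using m(2) by (intro mult_left_mono divide_right_mono) (auto simp: L_def)
        also have "\<dots> \<le> real (card (H - S)) * (real (m - ?r) / real (2 ^ d - ?r))"
          using cH q by (intro mult_mono) auto
        finally have exponent: "2 powr (\<epsilon> / 2 * d) / (8 * real ?r)
          \<le> real (card (H - S)) * (real (m - ?r) / real (2 ^ d - ?r))" .
        have "real (card {W. S \<subseteq> W \<and> W \<subseteq> cube01 d \<and> card W = m \<and> W \<inter> (H - S) = {}})
            \<le> exp (- (real (card (H - S)) * (real (m - card S) / real (card (cube01 d) - card S))))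
              * real ((card (cube01 d) - card S) choose (m - card S))"
          using S(1) m m' f(2) by (intro card_supersets_avoiding_le finite_cube01) (auto simp: card_cube01 S(2))
        also have "\<dots> = exp (- (real (card (H - S)) * (real (m - ?r) / real (2 ^ d - ?r)))) * ?C"
          by (simp only: card_cube01 S(2))
        also have "\<dots> \<le> exp (- (2 powr (\<epsilon> / 2 * d) / (8 * real ?r))) * ?C"
          using exponent by (intro mult_right_mono) auto
        finally show ?thesis .
      qed
      have "card {W. S \<subseteq> W \<and> W \<subseteq> cube01 d \<and> card W = m \<and> (\<exists>F. F face_of convex hull W \<and> S \<subseteq> F \<and> F \<subseteq> affine hull S)}
          \<le> card (\<Union>H\<in>?Fam. {W. S \<subseteq> W \<and> W \<subseteq> cube01 d \<and> card W = m \<and> W \<inter> (H - S) = {}})"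
        by (rule card_mono[OF _ sub], rule finite_subset[of _ "Pow (cube01 d)"]) (auto simp: finite_cube01)
      also have "\<dots> \<le> (\<Sum>H\<in>?Fam. card {W. S \<subseteq> W \<and> W \<subseteq> cube01 d \<and> card W = m \<and> W \<inter> (H - S) = {}})"
        by (rule card_UN_le[OF finFam])
      finally have "real (card {W. S \<subseteq> W \<and> W \<subseteq> cube01 d \<and> card W = m \<and> (\<exists>F. F face_of convex hull W \<and> S \<subseteq> F \<and> F \<subseteq> affine hull S)})
          \<le> (\<Sum>H\<in>?Fam. real (card {W. S \<subseteq> W \<and> W \<subseteq> cube01 d \<and> card W = m \<and> W \<inter> (H - S) = {}}))"
        unfolding of_nat_sum[symmetric] by (rule of_nat_mono)
      also have "\<dots> \<le> (\<Sum>H\<in>?Fam. exp (- (2 powr (\<epsilon> / 2 * d) / (8 * real ?r))) * ?C)"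
        by (rule sum_mono) (rule each)
      also have "\<dots> = real (card ?Fam) * (exp (- (2 powr (\<epsilon> / 2 * d) / (8 * real ?r))) * ?C)" by (rule sum_constant)
      also have "\<dots> \<le> ((2 ^ d) ^ d + 1) * (exp (- (2 powr (\<epsilon> / 2 * d) / (8 * real ?r))) * ?C)"
      proof (rule mult_right_mono)
        show "real (card ?Fam) \<le> (2 ^ d) ^ d + 1" using of_nat_mono[OF Fam, where ?'a = real] by simp
      qed simp
      finally show "real (card {W. S \<subseteq> W \<and> W \<subseteq> cube01 d \<and> card W = m \<and> (\<exists>F. F face_of convex hull W \<and> S \<subseteq> F \<and> F \<subseteq> affine hull S)})
          \<le> ?p * ?C" by (simp only: mult.assoc)
    qed simp
    also have "real (card {S \<in> ?B. S \<subseteq> cube01 d \<and> card S = ?r}) / real (2 ^ d choose ?r)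
        \<le> 2 ^ (3 * ?r) * real ?r ^ ?r / (\<delta>\<^sup>2 * d)"
      using m' \<delta> d by (intro not_typical_fraction_le) auto
    finally show ?thesis by simp
  qed
  have \<tau>\<epsilon>: "\<tau> k + \<epsilon> > 0" using \<tau>_bounds[OF k] \<epsilon> by linarith
  have "\<forall>\<^sub>F d in sequentially. 0 < d \<and> 2 * ?r * (log 2 ?r)\<^sup>2 \<le> (\<epsilon> / 4)\<^sup>2 * d"
  proof (intro eventually_conj eventually_gt_at_top)
    have "filterlim (\<lambda>d. (\<epsilon> / 4)\<^sup>2 * real d) at_top sequentially" using \<epsilon> by real_asymp
    then show "\<forall>\<^sub>F d in sequentially. 2 * ?r * (log 2 ?r)\<^sup>2 \<le> (\<epsilon> / 4)\<^sup>2 * d"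
      by (simp add: filterlim_at_top)
  qed
  moreover have "\<forall>\<^sub>F d in sequentially. 2 * ?r \<le> 2 powr ((\<tau> k + \<epsilon>) * real d)"
  proof -
    have "filterlim (\<lambda>d. 2 powr ((\<tau> k + \<epsilon>) * real d)) at_top sequentially" using \<tau>\<epsilon> by real_asymp
    then show ?thesis by (simp add: filterlim_at_top)
  qed
  moreover have "\<forall>\<^sub>F d in sequentially. 2 * ?r * (2 * ?r) \<le> 2 powr (\<epsilon> / 2 * real d)"
  proof -
    have "filterlim (\<lambda>d. 2 powr (\<epsilon> / 2 * real d)) at_top sequentially" using \<epsilon> by real_asymp
    then show ?thesis by (simp add: filterlim_at_top)
  qed
  ultimately have "\<forall>\<^sub>F d in sequentially. \<forall>m. m \<le> 2 ^ d \<longrightarrow> real m \<ge> 2 powr ((\<tau> k + \<epsilon>) * d) \<longrightarrow>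
    expected_face_density k d m
      \<le> 2 ^ (3 * ?r) * real ?r ^ ?r / (\<delta>\<^sup>2 * d)
        + ((2 ^ d) ^ d + 1) * exp (- (2 powr (\<epsilon> / 2 * d) / (8 * real ?r)))"
  proof eventually_elim
    case (elim d)
    show ?case
    proof (intro allI impI, goal_cases)
      case m: (1 m)
      \<comment> \<open>An admissible m forces \<tau> k + \<epsilon> \<le> 1, hence 1 - \<tau> k -
        \<epsilon> / 2 \<ge> \<epsilon> / 2; this makes \<open>L d\<close> large.\<close>
      have "2 powr ((\<tau> k + \<epsilon>) * real d) \<le> 2 ^ d"
      proof -
        have "real m \<le> real (2 ^ d)" using m(1) by (rule of_nat_mono)
        from order_trans[OF m(2) this] show ?thesis by (simp only: of_nat_power of_nat_numeral)
      qed
      then have "2 powr ((\<tau> k + \<epsilon>) * real d) \<le> 2 powr real d" by (simp add: powr_realpow)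
      then have "(\<tau> k + \<epsilon>) * real d \<le> 1 * real d" by simp
      then have "\<epsilon> / 2 \<le> 1 - \<tau> k - \<epsilon> / 2" using elim(1) by (subst (asm) mult_le_cancel_right_pos) auto
      then have "2 powr (\<epsilon> / 2 * d) \<le> 2 powr ((1 - \<tau> k - \<epsilon> / 2) * d)"
        by (intro powr_mono mult_right_mono) auto
      then have "2 * real ?r * (2 * real ?r) \<le> 2 powr ((1 - \<tau> k - \<epsilon> / 2) * d)"
        using elim(3) unfolding of_nat_mult of_nat_numeral by (rule order_trans[rotated])
      then have "L d \<ge> 2 * ?r" unfolding L_def by (subst le_divide_eq) (auto simp: mult_ac)
      then show ?case using elim m by (intro bound) auto
    qed
  qed
  then show ?thesis using \<delta>(1) by blast
qed

theorem theorem2: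
  fixes k :: nat and \<epsilon> :: real and n :: "nat \<Rightarrow> nat"
  assumes "k \<ge> 1"
    and "\<epsilon> > 0"
    and "\<forall>d. 1 \<le> n d \<and> n d \<le> 2 ^ d"
    and "\<forall>\<^sub>F d in sequentially. n d \<ge> k + 1"
  shows "((\<forall>d. real (n d) \<le> 2 powr ((\<tau> k - \<epsilon>) * real d)) \<longrightarrow>
            (\<lambda>d. 1 - expected_face_density k d (n d)) \<in> o(\<lambda>d. 1)) \<and>
         ((\<forall>d. real (n d) \<ge> 2 powr ((\<tau> k + \<epsilon>) * real d)) \<longrightarrow>
            (\<lambda>d. expected_face_density k d (n d)) \<in> o(\<lambda>d. 1))"
proof (intro conjI impI)
  define K where "K = 2 ^ (3 * (k + 1)) * real (k + 1) ^ (k + 1)"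
  assume le: "\<forall>d. real (n d) \<le> 2 powr ((\<tau> k - \<epsilon>) * real d)"
  obtain \<delta> :: real where \<delta>: "\<delta> > 0" and bound: "\<forall>d m. 0 < d \<longrightarrow> k + 1 \<le> m \<longrightarrow> m \<le> 2 ^ d \<longrightarrow>
      real m \<le> 2 powr ((\<tau> k - \<epsilon>) * d) \<longrightarrow>
      1 - expected_face_density k d m \<le> K / (\<delta>\<^sup>2 * d) + 2 powr (- (\<epsilon> / 2) * d)"
    using expected_face_density_lower[OF assms(1,2), folded K_def] by (elim exE conjE)
  have "(\<lambda>d. 1 - expected_face_density k d (n d)) \<longlonglongrightarrow> 0"
  proof (rule tendsto_sandwich)
    show "\<forall>\<^sub>F d in sequentially. 0 \<le> 1 - expected_face_density k d (n d)"
      using assms(4) by eventually_elim (use expected_face_density_le_1 assms(3) in auto)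
    show "\<forall>\<^sub>F d in sequentially. 1 - expected_face_density k d (n d) \<le> K / (\<delta>\<^sup>2 * d) + 2 powr (- (\<epsilon> / 2) * d)"
      using assms(4) eventually_gt_at_top[of 0] by eventually_elim (use bound assms(3) le in auto)
    show "(\<lambda>d. K / (\<delta>\<^sup>2 * real d) + 2 powr (- (\<epsilon> / 2) * real d)) \<longlonglongrightarrow> 0"
      using \<delta> assms(2) by real_asymp
  qed simp
  then show "(\<lambda>d. 1 - expected_face_density k d (n d)) \<in> o(\<lambda>d. 1)" by (intro smalloI_tendsto) auto
next
  define K where "K = 2 ^ (3 * (k + 1)) * real (k + 1) ^ (k + 1)"
  assume ge: "\<forall>d. real (n d) \<ge> 2 powr ((\<tau> k + \<epsilon>) * real d)"
  obtain \<delta> :: real where \<delta>: "\<delta> > 0" and bound: "\<forall>\<^sub>F d in sequentially. \<forall>m. m \<le> 2 ^ d \<longrightarrow>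
      real m \<ge> 2 powr ((\<tau> k + \<epsilon>) * d) \<longrightarrow> expected_face_density k d m \<le> K / (\<delta>\<^sup>2 * d)
        + ((2 ^ d) ^ d + 1) * exp (- (2 powr (\<epsilon> / 2 * d) / (8 * real (k + 1))))"
    using expected_face_density_upper[OF assms(1,2), folded K_def] by (elim exE conjE)
  have "(\<lambda>d. expected_face_density k d (n d)) \<longlonglongrightarrow> 0"
  proof (rule tendsto_sandwich)
    show "\<forall>\<^sub>F d in sequentially. 0 \<le> expected_face_density k d (n d)"
      by (simp add: expected_face_density_nonneg)
    show "\<forall>\<^sub>F d in sequentially. expected_face_density k d (n d) \<le> K / (\<delta>\<^sup>2 * d)
        + ((2 ^ d) ^ d + 1) * exp (- (2 powr (\<epsilon> / 2 * d) / (8 * real (k + 1))))"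
      using bound by eventually_elim (use assms(3) ge in auto)
    \<comment> \<open>The number of traces is written as a single power of 2 with exponent d * d, so
      that its growth can be compared with the exponential factor.\<close>
    have "(\<lambda>d. K / (\<delta>\<^sup>2 * real d)
        + (2 powr (real d * real d) + 1) * exp (- (2 powr (\<epsilon> / 2 * real d) / (8 * real (k + 1))))) \<longlonglongrightarrow> 0"
      using \<delta> assms(2) by real_asymp
    moreover have "2 powr (real d * real d) = (2 ^ d) ^ d" for d :: nat
      by (simp add: powr_powr[symmetric] powr_realpow)
    ultimately show "(\<lambda>d. K / (\<delta>\<^sup>2 * real d)
        + ((2 ^ d) ^ d + 1) * exp (- (2 powr (\<epsilon> / 2 * real d) / (8 * real (k + 1))))) \<longlonglongrightarrow> 0"
      by simp
  qed simp
  then show "(\<lambda>d. expected_face_density k d (n d)) \<in> o(\<lambda>d. 1)" by (intro smalloI_tendsto) auto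
qed

end
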